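(* Let $K$ be a field, $R=K[x_1,\ldots,x_n]$, and let $I$ and $J$ be two monomial ideals of $R$ intersecting transversally, i.e. such that $I\cap J=IJ$. Let $\mathbb{T}(I)_{\bullet}$ and $\mathbb{T}(J)_{\bullet}$ be the Taylor resolutions of $I$ and $J$ respectively. Then the Taylor resolution $\mathbb{T}(I+J)_{\bullet}$ of $I+J$ is isomorphic to the complex $\mathbb{T}(I)_{\bullet}\otimes_R \mathbb{T}(J)_{\bullet}$, and hence $\mathbb{T}(I)_{\bullet}\otimes_R \mathbb{T}(J)_{\bullet}$ is acyclic.
   Context: A monomial ideal is an ideal generated by monomials; each has a unique minimal monomial generating set. Let $M$ be a monomial ideal of $R$ minimally generated by the monomials $m_1,\ldots,m_p$. The Taylor complex (Taylor resolution) $(\mathbb{T}(M)_{\bullet},\delta(M)_{\bullet})$ is the complex in which $\mathbb{T}(M)_i$ is the free $R$-module with basis $e_{j_1}\wedge\cdots\wedge e_{j_i}$, $1\le j_1<\cdots<j_i\le p$ (so $\mathbb{T}(M)_0=R$), where $e_1,\ldots,e_p$ is the standard basis of $R^p$, with differential $$\delta(M)_i(e_{j_1}\wedge\cdots\wedge e_{j_i})=\sum_{1\le k\le i}(-1)^{k-1}\frac{\operatorname{lcm}(m_{j_1},\ldots,m_{j_i})}{\operatorname{lcm}(m_{j_1},\ldots,\widehat{m_{j_k}},\ldots,m_{j_i})}\,e_{j_1}\wedge\cdots\wedge\widehat{e_{j_k}}\wedge\cdots\wedge e_{j_i},$$ where the hat denotes omission and the lcm of the empty set is $1$. It is a known fact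 that $\mathbb{T}(M)_{\bullet}$ is a free resolution of $R/M$ (called a resolution of $M$). The tensor product of complexes is the usual one, with differential $d(a\otimes b)=d(a)\otimes b+(-1)^{i}a\otimes d(b)$ for $a$ of degree $i$. Acyclic means that the homology vanishes in all positive homological degrees.
   Formalization: The isomorphism is claimed only when it is not the case that one of I, J is all of R and the other is nonzero; there it fails (I = R, J = (x): degree-1 ranks are 1 and 2). Acyclicity is claimed in all cases. *)

theory Defs
  imports "HOL-Algebra.Algebra" "HOL-Algebra.Algebraic_Closure_Type"
begin

section \<open>Modules and complexes of modules\<close>

definition linear_maps ::
    "('r, 'a) ring_scheme \<Rightarrow> ('r, 'm, 'b) module_scheme \<Rightarrow> ('r, 'n, 'c) module_scheme \<Rightarrow> ('m \<Rightarrow> 'n) set"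
  where "linear_maps R M N = {f. f \<in> carrier M \<rightarrow> carrier N \<and>
    (\<forall>x\<in>carrier M. \<forall>y\<in>carrier M. f (x \<oplus>\<^bsub>M\<^esub> y) = f x \<oplus>\<^bsub>N\<^esub> f y) \<and>
    (\<forall>r\<in>carrier R. \<forall>x\<in>carrier M. f (r \<odot>\<^bsub>M\<^esub> x) = r \<odot>\<^bsub>N\<^esub> f x)}"

text \<open>Complexes are graded by the natural numbers, and the differential in degree \<open>i > 0\<close> maps
  degree \<open>i\<close> to degree \<open>i - 1\<close>. The value of \<open>bdry C 0\<close> is irrelevant.\<close>

record ('r, 'm) module_complex =
  chain :: "nat \<Rightarrow> ('r, 'm) module"
  bdry :: "nat \<Rightarrow> 'm \<Rightarrow> 'm"

definition chain_complex :: "('r, 'a) ring_scheme \<Rightarrow> ('r, 'm) module_complex \<Rightarrow> bool"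
  where "chain_complex R C \<longleftrightarrow>
    (\<forall>i. module R (chain C i)) \<and>
    (\<forall>i. bdry C (Suc i) \<in> linear_maps R (chain C (Suc i)) (chain C i)) \<and>
    (\<forall>i. \<forall>x\<in>carrier (chain C (Suc (Suc i))). bdry C (Suc i) (bdry C (Suc (Suc i)) x) = \<zero>\<^bsub>chain C i\<^esub>)"

definition isomorphic_complexes :: "('r, 'a) ring_scheme \<Rightarrow> ('r, 'm) module_complex \<Rightarrow> ('r, 'n) module_complex \<Rightarrow> bool"
  where "isomorphic_complexes R C D \<longleftrightarrow>
    chain_complex R C \<and> chain_complex R D \<and>
    (\<exists>f :: nat \<Rightarrow> 'm \<Rightarrow> 'n.
      (\<forall>i. f i \<in> linear_maps R (chain C i) (chain D i) \<and>
           bij_betw (f i) (carrier (chain C i)) (carrier (chain D i))) \<and>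
      (\<forall>i. \<forall>x\<in>carrier (chain C (Suc i)). f i (bdry C (Suc i) x) = bdry D (Suc i) (f (Suc i) x)))"

definition acyclic_complex :: "('r, 'a) ring_scheme \<Rightarrow> ('r, 'm) module_complex \<Rightarrow> bool"
  where "acyclic_complex R C \<longleftrightarrow>
    chain_complex R C \<and>
    (\<forall>i. a_kernel (chain C (Suc i)) (chain C i) (bdry C (Suc i))
         = bdry C (Suc (Suc i)) ` carrier (chain C (Suc (Suc i))))"


section \<open>Tensor products\<close>

text \<open>The tensor product of two modules is the quotient of the free abelian group on the pairs
  \<open>(m, n)\<close> by the subgroup \<open>tensor_null\<close> generated by the usual relations.\<close>

definition tensor_relations ::
    "('r, 'a) ring_scheme \<Rightarrow> ('r, 'm) module \<Rightarrow> ('r, 'n) module \<Rightarrow> ('m \<times> 'n \<Rightarrow>\<^sub>0 int) set"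
  where "tensor_relations R M N =
    {frag_of (m \<oplus>\<^bsub>M\<^esub> m', n) - frag_of (m, n) - frag_of (m', n) | m m' n.
       m \<in> carrier M \<and> m' \<in> carrier M \<and> n \<in> carrier N} \<union>
    {frag_of (m, n \<oplus>\<^bsub>N\<^esub> n') - frag_of (m, n) - frag_of (m, n') | m n n'.
       m \<in> carrier M \<and> n \<in> carrier N \<and> n' \<in> carrier N} \<union>
    {frag_of (r \<odot>\<^bsub>M\<^esub> m, n) - frag_of (m, r \<odot>\<^bsub>N\<^esub> n) | r m n.
       r \<in> carrier R \<and> m \<in> carrier M \<and> n \<in> carrier N}"

definition tensor_null ::
    "('r, 'a) ring_scheme \<Rightarrow> ('r, 'm) module \<Rightarrow> ('r, 'n) module \<Rightarrow> ('m \<times> 'n \<Rightarrow>\<^sub>0 int) set"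
  where "tensor_null R M N =
    generate (free_Abelian_group (carrier M \<times> carrier N)) (tensor_relations R M N)"

text \<open>\<open>tensor_map R M' N' f g\<close> is the map \<open>M \<otimes> N \<rightarrow> M' \<otimes> N'\<close> induced by
  \<open>f : M \<rightarrow> M'\<close> and \<open>g : N \<rightarrow> N'\<close>: it sends a coset \<open>Z\<close> to the coset of \<open>tensor_null R M' N'\<close>
  that contains the image of \<open>Z\<close> under \<open>(m, n) \<mapsto> (f m, g n)\<close>.\<close>

definition tensor_map ::
    "('r, 'a) ring_scheme \<Rightarrow> ('r, 'm') module \<Rightarrow> ('r, 'n') module \<Rightarrow> ('m \<Rightarrow> 'm') \<Rightarrow> ('n \<Rightarrow> 'n') \<Rightarrow>
      ('m \<times> 'n \<Rightarrow>\<^sub>0 int) set \<Rightarrow> ('m' \<times> 'n' \<Rightarrow>\<^sub>0 int) set"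
  where "tensor_map R M' N' f g Z =
    tensor_null R M' N' <#>\<^bsub>free_Abelian_group (carrier M' \<times> carrier N')\<^esub>
      (frag_extend (\<lambda>(m, n). frag_of (f m, g n)) ` Z)"

definition tensor_module ::
    "('r, 'a) ring_scheme \<Rightarrow> ('r, 'm) module \<Rightarrow> ('r, 'n) module \<Rightarrow> ('r, ('m \<times> 'n \<Rightarrow>\<^sub>0 int) set) module"
  where "tensor_module R M N =
    (let Q = free_Abelian_group (carrier M \<times> carrier N) Mod tensor_null R M N in
      \<lparr>carrier = carrier Q, monoid.mult = undefined, one = undefined,
       ring.zero = one Q, add = monoid.mult Q,
       module.smult = (\<lambda>r. tensor_map R M N (\<lambda>m. r \<odot>\<^bsub>M\<^esub> m) (\<lambda>n. n))\<rparr>)"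

text \<open>Degree \<open>i\<close> of the tensor product of complexes is the direct sum over \<open>p \<le> i\<close> of
  \<open>C\<^sub>p \<otimes> D\<^bsub>i-p\<^esub>\<close>, represented by families indexed by \<open>p\<close>. The differential is
  \<open>d (a \<otimes> b) = d a \<otimes> b + (-1)\<^sup>p (a \<otimes> d b)\<close> for \<open>a\<close> of degree \<open>p\<close>. Hence the component
  of \<open>d x\<close> at \<open>p\<close>, in \<open>C\<^sub>p \<otimes> D\<^bsub>i-1-p\<^esub>\<close>, has contributions from the components of \<open>x\<close> at
  \<open>p + 1\<close> and at \<open>p\<close>.\<close>

definition tensor_complex ::
    "('r, 'a) ring_scheme \<Rightarrow> ('r, 'm) module_complex \<Rightarrow> ('r, 'n) module_complex \<Rightarrow>
      ('r, nat \<Rightarrow> ('m \<times> 'n \<Rightarrow>\<^sub>0 int) set) module_complex"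
  where "tensor_complex R C D =
    (let T = (\<lambda>p q. tensor_module R (chain C p) (chain D q)) in
      \<lparr>chain = (\<lambda>i.
         \<lparr>carrier = (\<Pi>\<^sub>E p\<in>{..i}. carrier (T p (i - p))), monoid.mult = undefined, one = undefined,
          ring.zero = (\<lambda>p\<in>{..i}. \<zero>\<^bsub>T p (i - p)\<^esub>),
          add = (\<lambda>x y. \<lambda>p\<in>{..i}. x p \<oplus>\<^bsub>T p (i - p)\<^esub> y p),
          module.smult = (\<lambda>r x. \<lambda>p\<in>{..i}. r \<odot>\<^bsub>T p (i - p)\<^esub> x p)\<rparr>),
       bdry = (\<lambda>i x. \<lambda>p\<in>{..i - 1}.
         tensor_map R (chain C p) (chain D (i - 1 - p)) (bdry C (p + 1)) (\<lambda>b. b) (x (p + 1))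
         \<oplus>\<^bsub>T p (i - 1 - p)\<^esub>
         ((\<ominus>\<^bsub>R\<^esub> \<one>\<^bsub>R\<^esub>) [^]\<^bsub>R\<^esub> p) \<odot>\<^bsub>T p (i - 1 - p)\<^esub>
           tensor_map R (chain C p) (chain D (i - 1 - p)) (\<lambda>a. a) (bdry D (i - p)) (x p))\<rparr>)"


section \<open>Monomial ideals\<close>

text \<open>The polynomial ring over a field \<open>'k\<close> in variables indexed by a finite type \<open>'n\<close>. A monomial
  is represented by its exponent vector, of type \<open>'n \<Rightarrow>\<^sub>0 nat\<close>.\<close>

type_synonym ('n, 'k) mpoly = "('n \<Rightarrow>\<^sub>0 nat) \<Rightarrow>\<^sub>0 'k"

abbreviation mpoly_ring :: "('n::finite, 'k::field) mpoly ring"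
  where "mpoly_ring \<equiv> ring_of_type_algebra"

definition monomial :: "('n \<Rightarrow>\<^sub>0 nat) \<Rightarrow> ('n::finite, 'k::field) mpoly"
  where "monomial t = Poly_Mapping.single t 1"

definition monomial_ideal :: "('n::finite, 'k::field) mpoly set \<Rightarrow> bool"
  where "monomial_ideal I \<longleftrightarrow> (\<exists>S. I = Idl\<^bsub>mpoly_ring\<^esub> (monomial ` S))"

text \<open>The list \<open>ms\<close> enumerates, in some order, the minimal monomial generating set.\<close>

definition minimal_generators :: "('n \<Rightarrow>\<^sub>0 nat) list \<Rightarrow> ('n::finite, 'k::field) mpoly set \<Rightarrow> bool"
  where "minimal_generators ms I \<longleftrightarrow>
    distinct ms \<and> I = Idl\<^bsub>mpoly_ring\<^esub> (monomial ` set ms) \<and>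
    (\<forall>S. S \<subset> set ms \<longrightarrow> I \<noteq> Idl\<^bsub>mpoly_ring\<^esub> (monomial ` S))"

definition lcm_exponents :: "('n::finite \<Rightarrow>\<^sub>0 nat) set \<Rightarrow> ('n \<Rightarrow>\<^sub>0 nat)"
  where "lcm_exponents S = Abs_poly_mapping (\<lambda>v. Max (insert 0 ((\<lambda>t. Poly_Mapping.lookup t v) ` S)))"

lemma lookup_lcm_exponents:
  "Poly_Mapping.lookup (lcm_exponents S) v = Max (insert 0 ((\<lambda>t. Poly_Mapping.lookup t v) ` S))"
  unfolding lcm_exponents_def by (subst lookup_Abs_poly_mapping) simp_all

lemma lcm_exponents_empty: "lcm_exponents {} = 0"
  by (rule poly_mapping_eqI) (simp add: lookup_lcm_exponents)

lemma monomial_dvd_iff: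
  fixes s t :: "'n::finite \<Rightarrow>\<^sub>0 nat"
  shows "(monomial s :: ('n, 'k::field) mpoly) dvd monomial t \<longleftrightarrow>
    (\<forall>v. Poly_Mapping.lookup s v \<le> Poly_Mapping.lookup t v)"
proof
  assume "(monomial s :: ('n, 'k) mpoly) dvd monomial t"
  then obtain q :: "('n, 'k) mpoly" where q: "monomial t = monomial s * q"
    by (auto simp: dvd_def)
  have "t \<in> Poly_Mapping.keys (monomial s * q)"
    unfolding q[symmetric] by (simp add: monomial_def)
  then obtain u where "t = s + u"
    using keys_mult[of "monomial s" q] by (force simp: monomial_def)
  then show "\<forall>v. Poly_Mapping.lookup s v \<le> Poly_Mapping.lookup t v"
    by (simp add: lookup_add)
next
  assume le: "\<forall>v. Poly_Mapping.lookup s v \<le> Poly_Mapping.lookup t v"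
  have "s + (t - s) = t"
    using le by (intro poly_mapping_eqI) (simp add: lookup_add lookup_minus)
  then have "monomial t = monomial s * (monomial (t - s) :: ('n, 'k) mpoly)"
    by (simp add: monomial_def mult_single)
  then show "(monomial s :: ('n, 'k) mpoly) dvd monomial t"
    by (metis dvd_triv_left)
qed

lemma monomial_lcm_dvd_iff:
  fixes S :: "('n::finite \<Rightarrow>\<^sub>0 nat) set"
  assumes "finite S"
  shows "(monomial (lcm_exponents S) :: ('n, 'k::field) mpoly) dvd monomial t \<longleftrightarrow>
    (\<forall>s\<in>S. (monomial s :: ('n, 'k) mpoly) dvd monomial t)"
  using assms by (auto simp: monomial_dvd_iff lookup_lcm_exponents)


section \<open>The Taylor complex\<close>

definition free_module :: "'b set \<Rightarrow> ('r::comm_ring_1, 'b \<Rightarrow>\<^sub>0 'r) module"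
  where "free_module B =
    \<lparr>carrier = {x. Poly_Mapping.keys x \<subseteq> B}, monoid.mult = undefined, one = undefined,
     ring.zero = 0, add = (+), module.smult = (\<lambda>r. Poly_Mapping.map ((*) r))\<rparr>"

text \<open>The basis element \<open>e\<^bsub>j\<^sub>1\<^esub> \<and> \<dots> \<and> e\<^bsub>j\<^sub>i\<^esub>\<close> with \<open>j\<^sub>1 < \<dots> < j\<^sub>i\<close> is represented by the
  set \<open>\<sigma> = {j\<^sub>1, \<dots>, j\<^sub>i}\<close>; indices start at 0. For \<open>j = j\<^sub>k\<close> the number \<open>k - 1\<close> is
  \<open>card {l \<in> \<sigma>. l < j}\<close>. The quotient of two monomials, the second dividing the first, is the
  monomial whose exponent vector is the difference.\<close>

definition taylor_lcm :: "('n::finite \<Rightarrow>\<^sub>0 nat) list \<Rightarrow> nat set \<Rightarrow> ('n \<Rightarrow>\<^sub>0 nat)"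
  where "taylor_lcm ms \<sigma> = lcm_exponents ((\<lambda>j. ms ! j) ` \<sigma>)"

definition taylor_bdry_basis ::
    "('n::finite \<Rightarrow>\<^sub>0 nat) list \<Rightarrow> nat set \<Rightarrow> (nat set \<Rightarrow>\<^sub>0 ('n, 'k::field) mpoly)"
  where "taylor_bdry_basis ms \<sigma> =
    (\<Sum>j\<in>\<sigma>. Poly_Mapping.single (\<sigma> - {j})
      ((-1) ^ card {l\<in>\<sigma>. l < j} * monomial (taylor_lcm ms \<sigma> - taylor_lcm ms (\<sigma> - {j}))))"

definition taylor_complex ::
    "('n::finite \<Rightarrow>\<^sub>0 nat) list \<Rightarrow> (('n, 'k::field) mpoly, nat set \<Rightarrow>\<^sub>0 ('n, 'k) mpoly) module_complex"
  where "taylor_complex ms =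
    \<lparr>chain = (\<lambda>i. free_module {\<sigma>. \<sigma> \<subseteq> {..<length ms} \<and> card \<sigma> = i}),
     bdry = (\<lambda>_ x. \<Sum>\<sigma>\<in>Poly_Mapping.keys x.
       Poly_Mapping.map ((*) (Poly_Mapping.lookup x \<sigma>)) (taylor_bdry_basis ms \<sigma>))\<rparr>"

end

theory Submission
  imports Defs
begin

text \<open>Transversality forces every minimal generator of \<open>I\<close> to be coprime to every minimal
  generator of \<open>J\<close>, so the least common multiple of a set of generators of \<open>I + J\<close> is
  the product of the least common multiples of its two parts. Cutting index sets into these parts therefore
  identifies the Taylor complex of the concatenated list of generators with the tensor product. Unless one ideal
  is the unit ideal and the other is nonzero, the concatenated list enumerates the minimal generators of
  \<open>I + J\<close>, and two enumerations give isomorphic Taylor complexes via the signs of permutations. The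
  Taylor complex of any list of monomials, minimal or not, is acyclic, because in each multidegree it is the
  augmented chain complex of a simplex; hence acyclicity of the tensor product needs no further case
  distinction.\<close>

section \<open>Linear extension\<close>

text \<open>The homology of the tensor product is Tor(R/I, R/J), and I \<inter> J = IJ says directly
  only that its first group vanishes. Coprimality reaches all degrees: the lcm of a generator of I
  and one of J lies in both ideals, hence in IJ, and is therefore divisible by a product of two
  generators. The proviso on unit ideals is genuine. For I = R and J = (x) the ideals are
  transversal, but the Taylor complex of I + J = R has total rank 2 and the tensor product has total
  rank 4. The main technical obstacle is the tensor product, a quotient of the free abelian group on
  all pairs of elements. Formal sums are evaluated in the free module on joined index sets; the
  kernel of this evaluation is the subgroup of relations, so each coset is the set of formal sums
  with a given value. The isomorphism is written in terms of these values, and the complex structure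
  of the tensor product is obtained by transport instead of being checked on cosets.\<close>

definition scale :: "'r::semiring_0 \<Rightarrow> ('a \<Rightarrow>\<^sub>0 'r) \<Rightarrow> ('a \<Rightarrow>\<^sub>0 'r)"
  where "scale r = Poly_Mapping.map ((*) r)"

lemma lookup_scale [simp]: "Poly_Mapping.lookup (scale r x) a = r * Poly_Mapping.lookup x a"
  by (auto simp: scale_def Poly_Mapping.map.rep_eq when_def)

lemma scale_single [simp]: "scale r (Poly_Mapping.single a c) = Poly_Mapping.single a (r * c)"
  by (rule poly_mapping_eqI) (simp add: lookup_single when_def)

lemma scale_zero_left [simp]: "scale 0 x = 0"
  by (rule poly_mapping_eqI) simp

lemma scale_zero_right [simp]: "scale r 0 = 0"
  by (rule poly_mapping_eqI) simp

lemma scale_one [simp]: "scale 1 x = (x :: 'a \<Rightarrow>\<^sub>0 'r::semiring_1)"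
  by (rule poly_mapping_eqI) simp

lemma scale_add_left: "scale (r + s) x = scale r x + scale s x"
  by (rule poly_mapping_eqI) (simp add: lookup_add algebra_simps)

lemma scale_add_right: "scale r (x + y) = scale r x + scale r y"
  by (rule poly_mapping_eqI) (simp add: lookup_add algebra_simps)

lemma scale_scale: "scale r (scale s x) = scale (r * s) x"
  by (rule poly_mapping_eqI) (simp add: algebra_simps)

lemma scale_sum: "scale r (\<Sum>i\<in>A. f i) = (\<Sum>i\<in>A. scale r (f i))"
  by (rule poly_mapping_eqI) (simp add: lookup_sum sum_distrib_left)

lemma keys_scale: "Poly_Mapping.keys (scale r x) \<subseteq> Poly_Mapping.keys x"
  by (auto simp: in_keys_iff)


text \<open>The summands are arbitrary functions of index and coefficient because three kinds of
  extension are needed: R-linear ones, integral ones on formal sums, and the contracting homotopy,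
  which looks at single terms of coefficients and is only shown to be additive.\<close>

definition sum_ext :: "('a \<Rightarrow> 'c::zero \<Rightarrow> 'd::comm_monoid_add) \<Rightarrow> ('a \<Rightarrow>\<^sub>0 'c) \<Rightarrow> 'd"
  where "sum_ext \<phi> x = (\<Sum>a\<in>Poly_Mapping.keys x. \<phi> a (Poly_Mapping.lookup x a))"

lemma sum_ext_zero [simp]: "sum_ext \<phi> 0 = 0"
  by (simp add: sum_ext_def)

lemma sum_ext_single [simp]: "\<phi> a 0 = 0 \<Longrightarrow> sum_ext \<phi> (Poly_Mapping.single a c) = \<phi> a c"
  by (simp add: sum_ext_def)

lemma sum_ext_eq_sum:
  assumes "finite A" "Poly_Mapping.keys x \<subseteq> A" "\<And>a. \<phi> a 0 = 0"
  shows "sum_ext \<phi> x = (\<Sum>a\<in>A. \<phi> a (Poly_Mapping.lookup x a))"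
  unfolding sum_ext_def using assms
  by (intro sum.mono_neutral_left) (auto simp: in_keys_iff)

lemma additive_sum_ext:
  fixes \<phi> :: "'a \<Rightarrow> 'c::ab_group_add \<Rightarrow> 'd::ab_group_add"
  assumes "\<And>a. additive (\<phi> a)"
  shows "additive (sum_ext \<phi>)"
proof
  fix x y :: "'a \<Rightarrow>\<^sub>0 'c"
  \<comment> \<open>Cancellation can make the support of the sum smaller, so all three sums are
    taken over the union.\<close>
  let ?A = "Poly_Mapping.keys x \<union> Poly_Mapping.keys y"
  have 0: "\<phi> a 0 = 0" for a
    using assms by (rule additive.zero)
  have "sum_ext \<phi> (x + y) = (\<Sum>a\<in>?A. \<phi> a (Poly_Mapping.lookup (x + y) a))"
    by (rule sum_ext_eq_sum) (auto simp: 0 keys_add)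
  also have "\<dots> = (\<Sum>a\<in>?A. \<phi> a (Poly_Mapping.lookup x a)) + (\<Sum>a\<in>?A. \<phi> a (Poly_Mapping.lookup y a))"
    by (simp add: lookup_add additive.add[OF assms] sum.distrib)
  also have "\<dots> = sum_ext \<phi> x + sum_ext \<phi> y"
    by (simp add: sum_ext_eq_sum[of ?A x] sum_ext_eq_sum[of ?A y] 0)
  finally show "sum_ext \<phi> (x + y) = sum_ext \<phi> x + sum_ext \<phi> y" .
qed

lemma poly_mapping_sum_single:
  "x = (\<Sum>a\<in>Poly_Mapping.keys x. Poly_Mapping.single a (Poly_Mapping.lookup x a))"
  by (rule poly_mapping_eqI) (simp add: lookup_sum lookup_single when_def in_keys_iff)

text \<open>The working principle for identities between additive maps: only single terms with index
  in the support of x are tested, so restrictions on that support remain available.\<close>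

lemma additive_eq_on_keys:
  assumes "additive f" "additive g"
    and "\<And>a c. a \<in> Poly_Mapping.keys x \<Longrightarrow> f (Poly_Mapping.single a c) = g (Poly_Mapping.single a c)"
  shows "f x = g x"
proof -
  have "f x = (\<Sum>a\<in>Poly_Mapping.keys x. f (Poly_Mapping.single a (Poly_Mapping.lookup x a)))"
    by (subst (1) poly_mapping_sum_single) (rule additive.sum[OF assms(1)])
  also have "\<dots> = (\<Sum>a\<in>Poly_Mapping.keys x. g (Poly_Mapping.single a (Poly_Mapping.lookup x a)))"
    using assms(3) by (intro sum.cong) auto
  also have "\<dots> = g x"
    by (subst (3) poly_mapping_sum_single) (rule additive.sum[OF assms(2), symmetric])
  finally show ?thesis .
qed

lemma additive_scale: "additive (scale r)" for r :: "'r::ring"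
  by unfold_locales (rule scale_add_right)

lemma additive_scale_left: "additive (\<lambda>r. scale r x)" for x :: "'a \<Rightarrow>\<^sub>0 'r::ring"
  by unfold_locales (rule scale_add_left)

lemma additive_compose: "additive f \<Longrightarrow> additive g \<Longrightarrow> additive (\<lambda>x. f (g x))"
  by (simp add: additive_def)

lemma additive_plus: "additive f \<Longrightarrow> additive g \<Longrightarrow> additive (\<lambda>x. f x + g x)"
  by (simp add: additive_def algebra_simps)

lemma additive_ident: "additive (\<lambda>x. x)"
  by (simp add: additive_def)


definition lin_ext :: "('a \<Rightarrow> 'b \<Rightarrow>\<^sub>0 'r) \<Rightarrow> ('a \<Rightarrow>\<^sub>0 'r::comm_ring_1) \<Rightarrow> ('b \<Rightarrow>\<^sub>0 'r)"
  where "lin_ext g = sum_ext (\<lambda>a r. scale r (g a))"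

lemma lin_ext_zero [simp]: "lin_ext g 0 = 0"
  by (simp add: lin_ext_def)

lemma lin_ext_single [simp]: "lin_ext g (Poly_Mapping.single a r) = scale r (g a)"
  by (simp add: lin_ext_def)

lemma additive_lin_ext: "additive (lin_ext g)"
  unfolding lin_ext_def by (intro additive_sum_ext additive_scale_left)

lemmas lin_ext_add = additive.add[OF additive_lin_ext]
  and lin_ext_sum = additive.sum[OF additive_lin_ext]

lemma lin_ext_scale: "lin_ext g (scale r x) = scale r (lin_ext g x)"
  by (rule additive_eq_on_keys[where x = x])
    (auto intro!: additive_compose[OF additive_lin_ext additive_scale]
      additive_compose[OF additive_scale additive_lin_ext] simp: scale_scale)

text \<open>Composites are again linear extensions, so identities between them reduce to basis
  vectors through \<open>lin_ext_cong\<close>.\<close>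

lemma lin_ext_lin_ext: "lin_ext g (lin_ext h x) = lin_ext (\<lambda>a. lin_ext g (h a)) x"
  by (rule additive_eq_on_keys[where x = x])
    (auto intro!: additive_compose[OF additive_lin_ext additive_lin_ext] additive_lin_ext
      simp: lin_ext_scale)

lemma lin_ext_cong:
  "(\<And>a. a \<in> Poly_Mapping.keys x \<Longrightarrow> g a = h a) \<Longrightarrow> lin_ext g x = lin_ext h x"
  by (simp add: lin_ext_def sum_ext_def)

lemma lin_ext_basis: "lin_ext (\<lambda>a. Poly_Mapping.single a 1) x = x"
  by (simp add: lin_ext_def sum_ext_def flip: poly_mapping_sum_single)

lemma lin_ext_zero_fun [simp]: "lin_ext (\<lambda>a. 0) x = 0"
  by (simp add: lin_ext_def sum_ext_def)

lemma lin_ext_add_fun: "lin_ext (\<lambda>a. g a + h a) x = lin_ext g x + lin_ext h x"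
  by (simp add: lin_ext_def sum_ext_def scale_add_right sum.distrib)

lemma lin_ext_scale_fun: "lin_ext (\<lambda>a. scale r (g a)) x = scale r (lin_ext g x)"
  by (simp add: lin_ext_def sum_ext_def scale_sum scale_scale mult.commute)

lemma keys_sum_subset:
  "(\<And>i. i \<in> A \<Longrightarrow> Poly_Mapping.keys (f i) \<subseteq> B) \<Longrightarrow> Poly_Mapping.keys (\<Sum>i\<in>A. f i) \<subseteq> B"
proof (induction A rule: infinite_finite_induct)
  case (insert a A)
  then show ?case
    using keys_add[of "f a" "sum f A"] by auto
qed auto

lemma keys_lin_ext:
  assumes "\<And>a. a \<in> Poly_Mapping.keys x \<Longrightarrow> Poly_Mapping.keys (g a) \<subseteq> B"
  shows "Poly_Mapping.keys (lin_ext g x) \<subseteq> B"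
  unfolding lin_ext_def sum_ext_def
  using assms keys_scale by (intro keys_sum_subset) fast


section \<open>Free modules over the ring of a type\<close>

lemma type_ring_simps [simp]:
  "carrier (ring_of_type_algebra :: 'r::comm_ring_1 ring) = UNIV"
  "x \<otimes>\<^bsub>ring_of_type_algebra\<^esub> y = x * (y :: 'r)"
  "x \<oplus>\<^bsub>ring_of_type_algebra\<^esub> y = x + (y :: 'r)"
  "\<one>\<^bsub>ring_of_type_algebra\<^esub> = (1 :: 'r)"
  "\<zero>\<^bsub>ring_of_type_algebra\<^esub> = (0 :: 'r)"
  by (simp_all add: ring_of_type_algebra_def)

lemma cring_type_ring: "cring (ring_of_type_algebra :: 'r::comm_ring_1 ring)"
  by (rule cring_from_type_algebra)

lemma type_ring_a_inv [simp]: "\<ominus>\<^bsub>ring_of_type_algebra\<^esub> x = - (x :: 'r::comm_ring_1)"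
proof -
  interpret cring "ring_of_type_algebra :: 'r ring"
    by (rule cring_type_ring)
  show ?thesis
    by (rule sum_zero_eq_neg[symmetric]) simp_all
qed

lemma type_ring_pow [simp]: "x [^]\<^bsub>ring_of_type_algebra\<^esub> (n::nat) = (x :: 'r::comm_ring_1) ^ n"
proof -
  interpret cring "ring_of_type_algebra :: 'r ring"
    by (rule cring_type_ring)
  show ?thesis
    by (induction n) (simp_all add: mult.commute)
qed

lemma free_module_simps [simp]:
  "carrier (free_module B) = {x. Poly_Mapping.keys x \<subseteq> B}"
  "\<zero>\<^bsub>free_module B\<^esub> = 0"
  "x \<oplus>\<^bsub>free_module B\<^esub> y = x + y"
  "r \<odot>\<^bsub>free_module B\<^esub> x = scale r x"
  by (simp_all add: free_module_def scale_def)

lemma module_free_module: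
  "module ring_of_type_algebra (free_module B :: ('r::comm_ring_1, 'b \<Rightarrow>\<^sub>0 'r) module)"
proof (rule moduleI)
  show "abelian_group (free_module B :: ('r, 'b \<Rightarrow>\<^sub>0 'r) module)"
  proof (rule abelian_groupI)
    fix x assume "x \<in> carrier (free_module B :: ('r, 'b \<Rightarrow>\<^sub>0 'r) module)"
    then show "\<exists>y\<in>carrier (free_module B). y \<oplus>\<^bsub>free_module B\<^esub> x = \<zero>\<^bsub>free_module B\<^esub>"
      by (intro bexI[of _ "- x"]) (auto simp: in_keys_iff)
  next
    fix x y assume "x \<in> carrier (free_module B :: ('r, 'b \<Rightarrow>\<^sub>0 'r) module)" "y \<in> carrier (free_module B :: ('r, 'b \<Rightarrow>\<^sub>0 'r) module)"
    then show "x \<oplus>\<^bsub>free_module B\<^esub> y \<in> carrier (free_module B :: ('r, 'b \<Rightarrow>\<^sub>0 'r) module)"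
      using keys_add[of x y] by auto
  qed (simp_all add: ac_simps)
next
  fix r and x assume "x \<in> carrier (free_module B :: ('r, 'b \<Rightarrow>\<^sub>0 'r) module)"
  then show "r \<odot>\<^bsub>free_module B\<^esub> x \<in> carrier (free_module B :: ('r, 'b \<Rightarrow>\<^sub>0 'r) module)"
    using keys_scale[of r x] by auto
qed (simp_all add: scale_add_left scale_add_right scale_scale cring_type_ring)

lemma lin_ext_linear_maps:
  assumes "\<And>b. b \<in> B \<Longrightarrow> Poly_Mapping.keys (g b) \<subseteq> C"
  shows "lin_ext g \<in> linear_maps ring_of_type_algebra (free_module B) (free_module C)"
  unfolding linear_maps_def
  by (auto simp: lin_ext_add lin_ext_scale intro!: subsetD[OF keys_lin_ext[of _ g C]] assms)


section \<open>Transport along isomorphisms\<close>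

text \<open>The zeros have to be matched by a hypothesis: N is a mere record until the end, so f 0 =
  0 cannot be derived from additivity by cancellation.\<close>

lemma module_transport:
  assumes M: "module R M" and bij: "bij_betw f (carrier M) (carrier N)"
    and add: "\<And>x y. x \<in> carrier M \<Longrightarrow> y \<in> carrier M \<Longrightarrow> f (x \<oplus>\<^bsub>M\<^esub> y) = f x \<oplus>\<^bsub>N\<^esub> f y"
    and smult: "\<And>r x. r \<in> carrier R \<Longrightarrow> x \<in> carrier M \<Longrightarrow> f (r \<odot>\<^bsub>M\<^esub> x) = r \<odot>\<^bsub>N\<^esub> f x"
    and f_zero: "f \<zero>\<^bsub>M\<^esub> = \<zero>\<^bsub>N\<^esub>"
  shows "module R N"
proof -
  interpret module R M by (rule M)
  have car: "carrier N = f ` carrier M"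
    using bij by (simp add: bij_betw_def)
  show ?thesis
  proof (rule moduleI)
    show "cring R" by (rule R.is_cring)
    show "abelian_group N"
    proof (rule abelian_groupI)
      fix x assume "x \<in> carrier N"
      then obtain x' where "x = f x'" "x' \<in> carrier M"
        by (auto simp: car)
      then show "\<exists>y\<in>carrier N. y \<oplus>\<^bsub>N\<^esub> x = \<zero>\<^bsub>N\<^esub>"
        using add[of "\<ominus>\<^bsub>M\<^esub> x'" x'] unfolding car
        by (intro bexI[of _ "f (\<ominus>\<^bsub>M\<^esub> x')"]) (simp_all add: M.l_neg f_zero)
    qed (auto simp: car simp flip: add f_zero simp: M.a_ac)
  qed (auto simp: car simp flip: add smult simp: smult_l_distr smult_r_distr smult_assoc1)
qed

lemma linear_mapsD:
  assumes "f \<in> linear_maps R M N"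
  shows "\<And>x. x \<in> carrier M \<Longrightarrow> f x \<in> carrier N"
    and "\<And>x y. x \<in> carrier M \<Longrightarrow> y \<in> carrier M \<Longrightarrow> f (x \<oplus>\<^bsub>M\<^esub> y) = f x \<oplus>\<^bsub>N\<^esub> f y"
    and "\<And>r x. r \<in> carrier R \<Longrightarrow> x \<in> carrier M \<Longrightarrow> f (r \<odot>\<^bsub>M\<^esub> x) = r \<odot>\<^bsub>N\<^esub> f x"
  using assms by (auto simp: linear_maps_def)

lemma linear_maps_zero:
  assumes "module R M" "module R N" "f \<in> linear_maps R M N"
  shows "f \<zero>\<^bsub>M\<^esub> = \<zero>\<^bsub>N\<^esub>"
proof -
  interpret M: module R M by fact
  interpret N: module R N by fact
  have "f \<zero>\<^bsub>M\<^esub> \<oplus>\<^bsub>N\<^esub> f \<zero>\<^bsub>M\<^esub> = f \<zero>\<^bsub>M\<^esub>"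
    using linear_mapsD(2)[OF assms(3) M.zero_closed M.zero_closed] by simp
  then show ?thesis
    using linear_mapsD(1)[OF assms(3) M.zero_closed] N.add.l_cancel_one by blast
qed

lemma linear_maps_compose:
  "f \<in> linear_maps R M N \<Longrightarrow> g \<in> linear_maps R N P \<Longrightarrow> (\<lambda>x. g (f x)) \<in> linear_maps R M P"
  by (simp add: linear_maps_def Pi_iff)

text \<open>Meant for the tensor complex as D: its module axioms, the linearity of its differential
  and d d = 0 are all carried over by f, so none of them has to be verified on cosets.\<close>

lemma isomorphic_complexes_transport:
  assumes C: "chain_complex R C"
    and bij: "\<And>i. bij_betw (f i) (carrier (chain C i)) (carrier (chain D i))"
    and add: "\<And>i x y. x \<in> carrier (chain C i) \<Longrightarrow> y \<in> carrier (chain C i) \<Longrightarrow>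
      f i (x \<oplus>\<^bsub>chain C i\<^esub> y) = f i x \<oplus>\<^bsub>chain D i\<^esub> f i y"
    and smult: "\<And>i r x. r \<in> carrier R \<Longrightarrow> x \<in> carrier (chain C i) \<Longrightarrow>
      f i (r \<odot>\<^bsub>chain C i\<^esub> x) = r \<odot>\<^bsub>chain D i\<^esub> f i x"
    and zero: "\<And>i. f i \<zero>\<^bsub>chain C i\<^esub> = \<zero>\<^bsub>chain D i\<^esub>"
    and comm: "\<And>i x. x \<in> carrier (chain C (Suc i)) \<Longrightarrow>
      f i (bdry C (Suc i) x) = bdry D (Suc i) (f (Suc i) x)"
  shows "isomorphic_complexes R C D"
proof -
  have mod: "module R (chain C i)" and lin: "bdry C (Suc i) \<in> linear_maps R (chain C (Suc i)) (chain C i)" for i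
    using C by (auto simp: chain_complex_def)
  have car: "carrier (chain D i) = f i ` carrier (chain C i)" for i
    using bij by (simp add: bij_betw_def)
  note closed = linear_mapsD(1)[OF lin]
  have modD: "module R (chain D i)" for i
    by (rule module_transport[OF mod bij add smult zero])
  have clM: "x \<oplus>\<^bsub>chain C i\<^esub> y \<in> carrier (chain C i)"
    if "x \<in> carrier (chain C i)" "y \<in> carrier (chain C i)" for x y i
  proof -
    interpret module R "chain C i" by (rule mod)
    show ?thesis using that by simp
  qed
  have clS: "r \<odot>\<^bsub>chain C i\<^esub> x \<in> carrier (chain C i)"
    if "x \<in> carrier (chain C i)" "r \<in> carrier R" for x r i
  proof -
    interpret module R "chain C i" by (rule mod)
    show ?thesis using that by simp
  qed
  have linD: "bdry D (Suc i) \<in> linear_maps R (chain D (Suc i)) (chain D i)" for i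
    unfolding linear_maps_def car
    by (auto simp flip: comm add smult simp: closed clM clS linear_mapsD(2,3)[OF lin])
  have "chain_complex R D"
    unfolding chain_complex_def using C
    by (auto simp: modD linD car chain_complex_def closed zero simp flip: comm)
  moreover have "f i \<in> linear_maps R (chain C i) (chain D i)" for i
    by (auto simp: linear_maps_def car add smult)
  ultimately show ?thesis
    unfolding isomorphic_complexes_def using C bij comm by blast
qed

lemma isomorphic_complexes_trans:
  assumes "isomorphic_complexes R C D" "isomorphic_complexes R D E"
  shows "isomorphic_complexes R C E"
proof -
  obtain f where f: "\<And>i. f i \<in> linear_maps R (chain C i) (chain D i)"
    "\<And>i. bij_betw (f i) (carrier (chain C i)) (carrier (chain D i))"
    "\<And>i x. x \<in> carrier (chain C (Suc i)) \<Longrightarrow> f i (bdry C (Suc i) x) = bdry D (Suc i) (f (Suc i) x)"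
    using assms(1) by (auto simp: isomorphic_complexes_def)
  obtain g where g: "\<And>i. g i \<in> linear_maps R (chain D i) (chain E i)"
    "\<And>i. bij_betw (g i) (carrier (chain D i)) (carrier (chain E i))"
    "\<And>i x. x \<in> carrier (chain D (Suc i)) \<Longrightarrow> g i (bdry D (Suc i) x) = bdry E (Suc i) (g (Suc i) x)"
    using assms(2) by (auto simp: isomorphic_complexes_def)
  have bij: "bij_betw (\<lambda>x. g i (f i x)) (carrier (chain C i)) (carrier (chain E i))" for i
    using bij_betw_trans[OF f(2) g(2)] by (simp add: comp_def)
  show ?thesis
    unfolding isomorphic_complexes_def
  proof (intro conjI exI[of _ "\<lambda>i x. g i (f i x)"] allI ballI)
    show "(\<lambda>x. g i (f i x)) \<in> linear_maps R (chain C i) (chain E i)" for i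
      by (rule linear_maps_compose[OF f(1) g(1)])
  qed (use assms bij f(3) g(3) linear_mapsD(1)[OF f(1)] in \<open>auto simp: isomorphic_complexes_def\<close>)
qed

lemma acyclic_complex_isomorphic:
  assumes iso: "isomorphic_complexes R C D" and ac: "acyclic_complex R C"
  shows "acyclic_complex R D"
proof -
  obtain f where f: "\<And>i. f i \<in> linear_maps R (chain C i) (chain D i)"
    "\<And>i. bij_betw (f i) (carrier (chain C i)) (carrier (chain D i))"
    "\<And>i x. x \<in> carrier (chain C (Suc i)) \<Longrightarrow> f i (bdry C (Suc i) x) = bdry D (Suc i) (f (Suc i) x)"
    using iso by (auto simp: isomorphic_complexes_def)
  have C: "chain_complex R C" and D: "chain_complex R D"
    using iso by (auto simp: isomorphic_complexes_def)
  have lin: "bdry C (Suc i) \<in> linear_maps R (chain C (Suc i)) (chain C i)" for i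
    using C by (auto simp: chain_complex_def)
  have mod: "module R (chain C i)" "module R (chain D i)" for i
    using C D by (auto simp: chain_complex_def)
  have zero: "f i \<zero>\<^bsub>chain C i\<^esub> = \<zero>\<^bsub>chain D i\<^esub>" for i
    using mod f(1) by (rule linear_maps_zero)
  have car: "carrier (chain D i) = f i ` carrier (chain C i)" and inj: "inj_on (f i) (carrier (chain C i))" for i
    using f(2)[of i] by (auto simp: bij_betw_def)
  have zc: "\<zero>\<^bsub>chain C i\<^esub> \<in> carrier (chain C i)" for i
    using mod(1)[of i] by (meson abelian_group.axioms(1) abelian_monoid.zero_closed module.axioms(2))
  have "a_kernel (chain D (Suc i)) (chain D i) (bdry D (Suc i)) =
      bdry D (Suc (Suc i)) ` carrier (chain D (Suc (Suc i)))" for i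
  proof -
    \<comment> \<open>Each \<open>f i\<close> is injective and sends zero to zero, so x is a cycle
      exactly if its image is one.\<close>
    have "a_kernel (chain D (Suc i)) (chain D i) (bdry D (Suc i)) =
        f (Suc i) ` a_kernel (chain C (Suc i)) (chain C i) (bdry C (Suc i))"
      using inj_on_eq_iff[OF inj[of i]] zc[of i] linear_mapsD(1)[OF lin[of i]]
      by (auto simp: a_kernel_def' car f(3)[symmetric] zero[symmetric])
    also have "\<dots> = f (Suc i) ` bdry C (Suc (Suc i)) ` carrier (chain C (Suc (Suc i)))"
      using ac by (simp add: acyclic_complex_def)
    also have "\<dots> = bdry D (Suc (Suc i)) ` carrier (chain D (Suc (Suc i)))"
      unfolding car image_image by (intro image_cong) (auto simp: f(3))
    finally show ?thesis .
  qed
  then show ?thesis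
    using D by (simp add: acyclic_complex_def)
qed


section \<open>The Taylor differential squares to zero\<close>

lemma sum_antisymmetric_eq_zero:
  fixes F :: "'a::linorder \<Rightarrow> 'a \<Rightarrow> 'b::ab_group_add"
  assumes "finite A" and "\<And>j k. j \<in> A \<Longrightarrow> k \<in> A \<Longrightarrow> j < k \<Longrightarrow> F k j = - F j k"
  shows "(\<Sum>j\<in>A. \<Sum>k\<in>A - {j}. F j k) = 0"
proof -
  let ?lt = "{(j, k). j \<in> A \<and> k \<in> A \<and> j < k}"
  have fin: "finite ?lt"
    by (rule finite_subset[of _ "A \<times> A"]) (use assms(1) in auto)
  let ?gt = "{(j, k). j \<in> A \<and> k \<in> A \<and> k < j}"
  have fin': "finite ?gt"
    by (rule finite_subset[of _ "A \<times> A"]) (use assms(1) in auto)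
  have "(\<Sum>j\<in>A. \<Sum>k\<in>A - {j}. F j k) = (\<Sum>(j, k)\<in>(SIGMA j:A. A - {j}). F j k)"
    using assms(1) by (simp add: sum.Sigma)
  also have "(SIGMA j:A. A - {j}) = ?lt \<union> ?gt"
    by auto
  also have "(\<Sum>(j, k)\<in>?lt \<union> ?gt. F j k) = (\<Sum>(j, k)\<in>?lt. F j k) + (\<Sum>(j, k)\<in>?gt. F j k)"
    by (rule sum.union_disjoint[OF fin fin']) auto
  \<comment> \<open>Swapping the coordinates matches the two halves, and the terms cancel in pairs.
    Nothing is divided by two, so characteristic 2 is covered.\<close>
  also have "(\<Sum>(j, k)\<in>?gt. F j k) = (\<Sum>(j, k)\<in>?lt. F k j)"
    by (rule sum.reindex_bij_witness[of _ prod.swap prod.swap]) auto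
  also have "(\<Sum>(j, k)\<in>?lt. F j k) + (\<Sum>(j, k)\<in>?lt. F k j) = (\<Sum>(j, k)\<in>?lt. F j k + F k j)"
    by (simp add: sum.distrib case_prod_unfold)
  also have "\<dots> = 0"
    by (rule sum.neutral) (use assms(2) in auto)
  finally show ?thesis .
qed

lemma taylor_complex_simps [simp]:
  "chain (taylor_complex ms) i = free_module {\<sigma>. \<sigma> \<subseteq> {..<length ms} \<and> card \<sigma> = i}"
  "bdry (taylor_complex ms) i = lin_ext (taylor_bdry_basis ms)"
  by (auto simp: taylor_complex_def lin_ext_def sum_ext_def scale_def)

lemma monomial_mult: "monomial s * monomial t = monomial (s + t)"
  by (simp add: monomial_def mult_single)

lemma exponents_diff_add:
  fixes s t :: "'n \<Rightarrow>\<^sub>0 nat"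
  assumes "Poly_Mapping.lookup s \<le> Poly_Mapping.lookup t"
  shows "t - s + s = t"
  using assms by (intro poly_mapping_eqI) (simp add: lookup_add lookup_minus le_fun_def)

lemma taylor_lcm_mono:
  assumes "\<tau> \<subseteq> \<sigma>" "finite \<sigma>"
  shows "Poly_Mapping.lookup (taylor_lcm ms \<tau>) \<le> Poly_Mapping.lookup (taylor_lcm ms \<sigma>)"
  unfolding le_fun_def taylor_lcm_def lookup_lcm_exponents
  using assms by (intro allI Max_mono) (auto intro: finite_subset)

text \<open>The universal property of the lcm. Divisibility of monomials is handled as the pointwise
  order of the exponent functions.\<close>

lemma taylor_lcm_le_iff:
  assumes "finite \<sigma>"
  shows "Poly_Mapping.lookup (taylor_lcm ms \<sigma>) \<le> Poly_Mapping.lookup t \<longleftrightarrow>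
    (\<forall>j\<in>\<sigma>. Poly_Mapping.lookup (ms ! j) \<le> Poly_Mapping.lookup t)"
  using assms by (auto simp: le_fun_def taylor_lcm_def lookup_lcm_exponents)

text \<open>The position of k drops by one exactly when a smaller index is removed; this shift is
  the source of the cancelling signs in d d.\<close>

lemma card_less_remove:
  fixes \<sigma> :: "nat set"
  assumes "finite \<sigma>" "j \<in> \<sigma>"
  shows "card {l \<in> \<sigma> - {j}. l < k} = card {l \<in> \<sigma>. l < k} - (if j < k then 1 else 0)"
proof -
  have "{l \<in> \<sigma> - {j}. l < k} = {l \<in> \<sigma>. l < k} - {j}"
    by auto
  then show ?thesis
    using assms by (simp add: card_Diff_singleton_if)
qed

lemma lin_ext_taylor_bdry_basis:
  "lin_ext g (taylor_bdry_basis ms \<sigma>) = (\<Sum>j\<in>\<sigma>.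
    scale ((-1) ^ card {l\<in>\<sigma>. l < j} * monomial (taylor_lcm ms \<sigma> - taylor_lcm ms (\<sigma> - {j}))) (g (\<sigma> - {j})))"
  by (simp add: taylor_bdry_basis_def lin_ext_sum)

text \<open>The two lcm quotients telescope to a monomial that does not depend on the order in which
  j and k are deleted, so only the signs differ, and they are opposite by the shift of
  positions.\<close>

lemma taylor_bdry_bdry_basis:
  assumes fin: "finite \<sigma>"
  shows "lin_ext (taylor_bdry_basis ms) (taylor_bdry_basis ms \<sigma> :: _ \<Rightarrow>\<^sub>0 ('n::finite, 'k::field) mpoly) = 0"
proof -
  define F :: "nat \<Rightarrow> nat \<Rightarrow> (nat set \<Rightarrow>\<^sub>0 ('n, 'k) mpoly)" where
    "F j k = Poly_Mapping.single (\<sigma> - {j} - {k})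
      ((-1) ^ (card {l\<in>\<sigma>. l < j} + card {l\<in>\<sigma> - {j}. l < k}) *
        monomial (taylor_lcm ms \<sigma> - taylor_lcm ms (\<sigma> - {j} - {k})))" for j k
  have mono: "monomial (taylor_lcm ms \<sigma> - taylor_lcm ms (\<sigma> - {j})) *
      monomial (taylor_lcm ms (\<sigma> - {j}) - taylor_lcm ms (\<sigma> - {j} - {k})) =
      (monomial (taylor_lcm ms \<sigma> - taylor_lcm ms (\<sigma> - {j} - {k})) :: ('n, 'k) mpoly)" for j k
  proof -
    have "Poly_Mapping.lookup (taylor_lcm ms (\<sigma> - {j})) \<le> Poly_Mapping.lookup (taylor_lcm ms \<sigma>)"
      "Poly_Mapping.lookup (taylor_lcm ms (\<sigma> - {j} - {k})) \<le> Poly_Mapping.lookup (taylor_lcm ms (\<sigma> - {j}))"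
      using fin by (auto intro!: taylor_lcm_mono)
    then have "taylor_lcm ms \<sigma> - taylor_lcm ms (\<sigma> - {j}) +
        (taylor_lcm ms (\<sigma> - {j}) - taylor_lcm ms (\<sigma> - {j} - {k})) =
        taylor_lcm ms \<sigma> - taylor_lcm ms (\<sigma> - {j} - {k})"
      by (intro poly_mapping_eqI) (simp add: lookup_add lookup_minus le_fun_def)
    then show ?thesis
      by (simp add: monomial_mult)
  qed
  have "lin_ext (taylor_bdry_basis ms) (taylor_bdry_basis ms \<sigma>) = (\<Sum>j\<in>\<sigma>. \<Sum>k\<in>\<sigma> - {j}. F j k)"
    unfolding lin_ext_taylor_bdry_basis F_def
    by (intro sum.cong refl) (simp add: taylor_bdry_basis_def scale_sum mono[symmetric] power_add mult_ac)
  also have "\<dots> = 0"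
  proof (rule sum_antisymmetric_eq_zero[OF fin])
    fix j k assume jk: "j \<in> \<sigma>" "k \<in> \<sigma>" "j < k"
    \<comment> \<open>\<open>card_less_remove\<close> subtracts natural numbers; as j itself lies
      below k, the subtraction is exact.\<close>
    have "card {l \<in> \<sigma>. l < k} > 0"
      using jk fin by (auto simp: card_gt_0_iff)
    then have "card {l\<in>\<sigma>. l < k} + card {l\<in>\<sigma> - {k}. l < j} =
        Suc (card {l\<in>\<sigma>. l < j} + card {l\<in>\<sigma> - {j}. l < k})"
      using card_less_remove[OF fin jk(1), of k] card_less_remove[OF fin jk(2), of j] jk(3) by simp
    moreover have "\<sigma> - {k} - {j} = \<sigma> - {j} - {k}"
      by auto
    ultimately show "F k j = - F j k"
      by (simp only: F_def power_Suc mult_1_left mult_minus1 mult_minus_left single_uminus)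
  qed
  finally show ?thesis .
qed

lemma keys_taylor_bdry_basis:
  assumes "\<sigma> \<subseteq> {..<n}" "card \<sigma> = Suc i"
  shows "Poly_Mapping.keys (taylor_bdry_basis ms \<sigma>) \<subseteq> {\<sigma>. \<sigma> \<subseteq> {..<n} \<and> card \<sigma> = i}"
  unfolding taylor_bdry_basis_def using assms
  by (intro keys_sum_subset) (auto split: if_splits)

lemma chain_complex_taylor:
  "chain_complex mpoly_ring (taylor_complex ms :: (('n::finite, 'k::field) mpoly, _) module_complex)"
  unfolding chain_complex_def taylor_complex_simps
proof (intro conjI allI ballI)
  show "lin_ext (taylor_bdry_basis ms) \<in> linear_maps (mpoly_ring :: ('n, 'k) mpoly ring)
      (free_module {\<sigma>. \<sigma> \<subseteq> {..<length ms} \<and> card \<sigma> = Suc i})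
      (free_module {\<sigma>. \<sigma> \<subseteq> {..<length ms} \<and> card \<sigma> = i})" for i
    using keys_taylor_bdry_basis by (intro lin_ext_linear_maps) blast
next
  fix i and x :: "nat set \<Rightarrow>\<^sub>0 ('n, 'k) mpoly"
  assume "x \<in> carrier (free_module {\<sigma>. \<sigma> \<subseteq> {..<length ms} \<and> card \<sigma> = Suc (Suc i)})"
  then have "lin_ext (taylor_bdry_basis ms) (lin_ext (taylor_bdry_basis ms) x) = lin_ext (\<lambda>\<sigma>. 0) x"
    unfolding lin_ext_lin_ext
    by (intro lin_ext_cong taylor_bdry_bdry_basis) (auto intro: finite_subset)
  then show "lin_ext (taylor_bdry_basis ms) (lin_ext (taylor_bdry_basis ms) x) =
      \<zero>\<^bsub>free_module {\<sigma>. \<sigma> \<subseteq> {..<length ms} \<and> card \<sigma> = i}\<^esub>"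
    by simp
qed (rule module_free_module)


section \<open>The Taylor complex is acyclic\<close>

text \<open>It depends on the multidegree t but not on the index set, so a simplex and its faces are
  coned from the same apex.\<close>

definition taylor_pivot :: "('n::finite \<Rightarrow>\<^sub>0 nat) list \<Rightarrow> ('n \<Rightarrow>\<^sub>0 nat) \<Rightarrow> nat"
  where "taylor_pivot ms t = (LEAST j. j < length ms \<and> Poly_Mapping.lookup (ms ! j) \<le> Poly_Mapping.lookup t)"

text \<open>This has multidegree \<open>t\<close> provided that the least common multiple of
  \<open>\<sigma>\<close> divides \<open>t\<close>; otherwise the subtraction truncates.\<close>

definition taylor_elem ::
    "('n::finite \<Rightarrow>\<^sub>0 nat) list \<Rightarrow> ('n \<Rightarrow>\<^sub>0 nat) \<Rightarrow> nat set \<Rightarrow> 'k::field \<Rightarrow> (nat set \<Rightarrow>\<^sub>0 ('n, 'k) mpoly)"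
  where "taylor_elem ms t \<sigma> c = Poly_Mapping.single \<sigma> (Poly_Mapping.single (t - taylor_lcm ms \<sigma>) c)"

text \<open>In multidegree \<open>t\<close> the Taylor complex is the augmented chain complex of the full
  simplex on the indices \<open>j\<close> such that \<open>ms ! j\<close> divides \<open>t\<close>, and the
  homotopy is the cone from its least vertex.\<close>

definition taylor_homotopy ::
    "('n::finite \<Rightarrow>\<^sub>0 nat) list \<Rightarrow> (nat set \<Rightarrow>\<^sub>0 ('n, 'k::field) mpoly) \<Rightarrow> (nat set \<Rightarrow>\<^sub>0 ('n, 'k) mpoly)"
  where "taylor_homotopy ms = sum_ext (\<lambda>\<sigma>. sum_ext (\<lambda>u c.
    let t = u + taylor_lcm ms \<sigma>; j = taylor_pivot ms t in
      if j \<in> \<sigma> then 0 else taylor_elem ms t (insert j \<sigma>) c))"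

lemma taylor_elem_zero [simp]: "taylor_elem ms t \<sigma> 0 = 0"
  by (simp add: taylor_elem_def)

lemma taylor_elem_uminus: "taylor_elem ms t \<sigma> (- c) = - taylor_elem ms t \<sigma> c"
  by (simp add: taylor_elem_def single_uminus)

lemma additive_taylor_homotopy: "additive (taylor_homotopy ms)"
  unfolding taylor_homotopy_def
  by (intro additive_sum_ext) (simp add: additive_def taylor_elem_def Let_def single_add)

lemma taylor_homotopy_elem:
  assumes "Poly_Mapping.lookup (taylor_lcm ms \<sigma>) \<le> Poly_Mapping.lookup t"
  shows "taylor_homotopy ms (taylor_elem ms t \<sigma> c) =
    (if taylor_pivot ms t \<in> \<sigma> then 0 else taylor_elem ms t (insert (taylor_pivot ms t) \<sigma>) c)"
  using assms by (simp add: taylor_homotopy_def taylor_elem_def[of ms t \<sigma>] Let_def exponents_diff_add)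

lemma minus_one_power_mult_single:
  "(-1) ^ m * Poly_Mapping.single u c = Poly_Mapping.single u ((-1) ^ m * (c :: 'k::comm_ring_1))"
  by (cases "even m") (auto simp: single_uminus)

text \<open>The lcm quotient in the differential compensates for the change of
  \<open>t - taylor_lcm ms \<sigma>\<close>. Hence the multidegree t is preserved, and over the
  field only the signed boundary of a simplex remains.\<close>

lemma taylor_bdry_elem:
  assumes "finite \<sigma>" "Poly_Mapping.lookup (taylor_lcm ms \<sigma>) \<le> Poly_Mapping.lookup t"
  shows "lin_ext (taylor_bdry_basis ms) (taylor_elem ms t \<sigma> c) =
    (\<Sum>k\<in>\<sigma>. taylor_elem ms t (\<sigma> - {k}) ((-1) ^ card {l\<in>\<sigma>. l < k} * c))"
proof -
  have "t - taylor_lcm ms \<sigma> + (taylor_lcm ms \<sigma> - taylor_lcm ms (\<sigma> - {k})) = t - taylor_lcm ms (\<sigma> - {k})" for k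
    using assms taylor_lcm_mono[of "\<sigma> - {k}" \<sigma> ms]
    by (intro poly_mapping_eqI) (simp add: lookup_add lookup_minus le_fun_def)
  then show ?thesis
    unfolding taylor_elem_def lin_ext_single taylor_bdry_basis_def scale_sum
    by (intro sum.cong refl) (simp add: monomial_def mult.left_commute mult_single minus_one_power_mult_single mult.commute[of c])
qed

text \<open>A nonempty index set provides a generator dividing t, so \<open>LEAST\<close> describes
  an actual index. This is where homological degree 0, which carries the homology R/M, is
  excluded.\<close>

lemma taylor_pivot:
  assumes "\<sigma> \<subseteq> {..<length ms}" "\<sigma> \<noteq> {}"
    and "Poly_Mapping.lookup (taylor_lcm ms \<sigma>) \<le> Poly_Mapping.lookup t"
  shows "taylor_pivot ms t < length ms"
    and "Poly_Mapping.lookup (ms ! taylor_pivot ms t) \<le> Poly_Mapping.lookup t"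
    and "l \<in> \<sigma> \<Longrightarrow> taylor_pivot ms t \<le> l"
proof -
  let ?P = "\<lambda>j. j < length ms \<and> Poly_Mapping.lookup (ms ! j) \<le> Poly_Mapping.lookup t"
  have P: "?P l" if "l \<in> \<sigma>" for l
    using assms that by (auto simp: taylor_lcm_le_iff finite_subset)
  then have "\<exists>l. ?P l"
    using assms(2) by blast
  then have "?P (taylor_pivot ms t)"
    unfolding taylor_pivot_def by (rule LeastI_ex)
  then show "taylor_pivot ms t < length ms"
    and "Poly_Mapping.lookup (ms ! taylor_pivot ms t) \<le> Poly_Mapping.lookup t"
    by auto
  show "l \<in> \<sigma> \<Longrightarrow> taylor_pivot ms t \<le> l"
    unfolding taylor_pivot_def using P by (intro Least_le)
qed

text \<open>The cone identity d h + h d = id. If the apex j lies in \<open>\<sigma>\<close>, then h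
  kills the simplex, and of its faces only the one opposite j survives h and is coned back.
  Otherwise the face of the cone opposite j is the simplex itself, and the other faces cancel
  against h d.\<close>

lemma taylor_homotopy_elem_eq:
  assumes \<sigma>: "\<sigma> \<subseteq> {..<length ms}" "\<sigma> \<noteq> {}"
    and le: "Poly_Mapping.lookup (taylor_lcm ms \<sigma>) \<le> Poly_Mapping.lookup t"
  shows "lin_ext (taylor_bdry_basis ms) (taylor_homotopy ms (taylor_elem ms t \<sigma> c)) +
    taylor_homotopy ms (lin_ext (taylor_bdry_basis ms) (taylor_elem ms t \<sigma> c)) = taylor_elem ms t \<sigma> c"
proof -
  have fin: "finite \<sigma>"
    using \<sigma>(1) by (rule finite_subset) simp
  define j where "j = taylor_pivot ms t"
  have j: "Poly_Mapping.lookup (ms ! j) \<le> Poly_Mapping.lookup t" "\<And>l. l \<in> \<sigma> \<Longrightarrow> j \<le> l"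
    using taylor_pivot[OF \<sigma> le] by (auto simp: j_def)
  have le': "Poly_Mapping.lookup (taylor_lcm ms (\<sigma> - {k})) \<le> Poly_Mapping.lookup t" for k
    using taylor_lcm_mono[of "\<sigma> - {k}" \<sigma> ms] fin le by (meson Diff_subset order_trans)
  have hd: "taylor_homotopy ms (lin_ext (taylor_bdry_basis ms) (taylor_elem ms t \<sigma> c)) =
      (\<Sum>k\<in>\<sigma>. if j \<in> \<sigma> - {k} then 0 else
        taylor_elem ms t (insert j (\<sigma> - {k})) ((-1) ^ card {l\<in>\<sigma>. l < k} * c))"
    unfolding taylor_bdry_elem[OF fin le] additive.sum[OF additive_taylor_homotopy]
      taylor_homotopy_elem[OF le'] j_def ..
  show ?thesis
  proof (cases "j \<in> \<sigma>")
    case True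
    \<comment> \<open>The apex is the least vertex, so deleting it carries the sign +1.\<close>
    have "{l \<in> \<sigma>. l < j} = {}"
      by (auto dest: j(2))
    then have first: "taylor_elem ms t (insert j (\<sigma> - {j})) ((-1) ^ card {l\<in>\<sigma>. l < j} * c) = taylor_elem ms t \<sigma> c"
      using True by (simp only: card.empty power_0 mult_1_left insert_Diff)
    have "(\<Sum>k\<in>\<sigma>. if j \<in> \<sigma> - {k} then 0 else
        taylor_elem ms t (insert j (\<sigma> - {k})) ((-1) ^ card {l\<in>\<sigma>. l < k} * c)) =
        (\<Sum>k\<in>\<sigma>. if j = k then taylor_elem ms t \<sigma> c else 0)"
    proof (intro sum.cong refl)
      fix k assume "k \<in> \<sigma>"
      then show "(if j \<in> \<sigma> - {k} then 0 else
        taylor_elem ms t (insert j (\<sigma> - {k})) ((-1) ^ card {l\<in>\<sigma>. l < k} * c)) =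
        (if j = k then taylor_elem ms t \<sigma> c else 0)"
        using True first by (cases "j = k") (simp_all only: Diff_iff singleton_iff if_True if_False simp_thms)
    qed
    also have "\<dots> = taylor_elem ms t \<sigma> c"
      using True fin by simp
    finally show ?thesis
      using True by (simp add: hd taylor_homotopy_elem[OF le] flip: j_def)
  next
    case False
    have le2: "Poly_Mapping.lookup (taylor_lcm ms (insert j \<sigma>)) \<le> Poly_Mapping.lookup t"
      using j(1) le fin by (simp add: taylor_lcm_le_iff)
    \<comment> \<open>The new vertex j comes first and moves all others up by one position, so the
      remaining faces change sign.\<close>
    have card: "card {l \<in> insert j \<sigma>. l < k} = Suc (card {l \<in> \<sigma>. l < k})" if "k \<in> \<sigma>" for k
    proof -
      have "{l \<in> insert j \<sigma>. l < k} = insert j {l \<in> \<sigma>. l < k}"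
        using j(2)[OF that] that False by (auto simp: le_less)
      then show ?thesis
        using False fin by simp
    qed
    have card0: "{l \<in> insert j \<sigma>. l < j} = {}"
      using j(2) by fastforce
    have ins: "insert j \<sigma> - {k} = insert j (\<sigma> - {k})" if "k \<in> \<sigma>" for k
      using that False by auto
    have rest: "(\<Sum>k\<in>\<sigma>. taylor_elem ms t (insert j \<sigma> - {k}) ((-1) ^ card {l\<in>insert j \<sigma>. l < k} * c)) =
        (\<Sum>k\<in>\<sigma>. - taylor_elem ms t (insert j (\<sigma> - {k})) ((-1) ^ card {l\<in>\<sigma>. l < k} * c))"
      by (intro sum.cong refl)
        (simp only: card ins power_Suc mult_1_left mult_minus1 mult_minus_left taylor_elem_uminus)
    have "insert j \<sigma> - {j} = \<sigma>"
      using False by simp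
    then have first: "taylor_elem ms t (insert j \<sigma> - {j}) ((-1) ^ card {l\<in>insert j \<sigma>. l < j} * c) =
        taylor_elem ms t \<sigma> c"
      by (simp only: card0 card.empty power_0 mult_1_left)
    have "lin_ext (taylor_bdry_basis ms) (taylor_elem ms t (insert j \<sigma>) c) =
      taylor_elem ms t \<sigma> c - (\<Sum>k\<in>\<sigma>. taylor_elem ms t (insert j (\<sigma> - {k})) ((-1) ^ card {l\<in>\<sigma>. l < k} * c))"
      unfolding taylor_bdry_elem[OF finite.insertI[OF fin] le2] sum.insert[OF fin False] first rest
      by (simp add: sum_negf)
    then show ?thesis
      using False by (simp add: hd taylor_homotopy_elem[OF le] flip: j_def)
  qed
qed

lemma taylor_homotopy_eq:
  fixes x :: "nat set \<Rightarrow>\<^sub>0 ('n::finite, 'k::field) mpoly"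
  assumes "Poly_Mapping.keys x \<subseteq> {\<sigma>. \<sigma> \<subseteq> {..<length ms} \<and> card \<sigma> = Suc i}"
  shows "lin_ext (taylor_bdry_basis ms) (taylor_homotopy ms x) +
    taylor_homotopy ms (lin_ext (taylor_bdry_basis ms) x) = x" (is "?H x = x")
proof (rule additive_eq_on_keys[where f = ?H and g = "\<lambda>x. x"])
  show addH: "additive ?H"
    by (intro additive_plus additive_compose[OF additive_lin_ext] additive_compose[OF additive_taylor_homotopy]
        additive_taylor_homotopy additive_lin_ext)
  fix \<sigma> and p :: "('n, 'k) mpoly"
  assume "\<sigma> \<in> Poly_Mapping.keys x"
  then have \<sigma>: "\<sigma> \<subseteq> {..<length ms}" "\<sigma> \<noteq> {}"
    using assms by auto
  have add_single: "additive (Poly_Mapping.single \<sigma> :: ('n, 'k) mpoly \<Rightarrow> _)"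
    by (simp add: additive_def single_add)
  show "?H (Poly_Mapping.single \<sigma> p) = Poly_Mapping.single \<sigma> p"
  proof (rule additive_eq_on_keys[where f = "\<lambda>p. ?H (Poly_Mapping.single \<sigma> p)"])
    fix u and c :: 'k
    \<comment> \<open>A single term of a coefficient is homogeneous, and its multidegree is a
      multiple of the lcm, so the truncated subtraction in \<open>taylor_elem\<close> is
      exact.\<close>
    have "Poly_Mapping.single \<sigma> (Poly_Mapping.single u c) = taylor_elem ms (u + taylor_lcm ms \<sigma>) \<sigma> c"
      by (simp add: taylor_elem_def)
    moreover have "Poly_Mapping.lookup (taylor_lcm ms \<sigma>) \<le> Poly_Mapping.lookup (u + taylor_lcm ms \<sigma>)"
      by (simp add: le_fun_def lookup_add)
    ultimately show "?H (Poly_Mapping.single \<sigma> (Poly_Mapping.single u c)) = Poly_Mapping.single \<sigma> (Poly_Mapping.single u c)"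
      using taylor_homotopy_elem_eq[OF \<sigma>] by simp
  qed (rule add_single additive_compose[OF addH])+
qed (rule additive_ident)

lemma keys_taylor_homotopy:
  assumes "Poly_Mapping.keys x \<subseteq> {\<sigma>. \<sigma> \<subseteq> {..<length ms} \<and> card \<sigma> = Suc i}"
  shows "Poly_Mapping.keys (taylor_homotopy ms x) \<subseteq> {\<sigma>. \<sigma> \<subseteq> {..<length ms} \<and> card \<sigma> = Suc (Suc i)}"
  unfolding taylor_homotopy_def sum_ext_def[of _ x] sum_ext_def[of _ "Poly_Mapping.lookup x _"]
proof (intro keys_sum_subset)
  fix \<sigma> u assume "\<sigma> \<in> Poly_Mapping.keys x"
  then have \<sigma>: "\<sigma> \<subseteq> {..<length ms}" "\<sigma> \<noteq> {}" "card \<sigma> = Suc i" "finite \<sigma>"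
    using assms by (auto intro: finite_subset)
  have "Poly_Mapping.lookup (taylor_lcm ms \<sigma>) \<le> Poly_Mapping.lookup (u + taylor_lcm ms \<sigma>)"
    by (simp add: le_fun_def lookup_add)
  from taylor_pivot(1)[OF \<sigma>(1,2) this]
  show "Poly_Mapping.keys (let t = u + taylor_lcm ms \<sigma>; j = taylor_pivot ms t
      in if j \<in> \<sigma> then 0 else taylor_elem ms t (insert j \<sigma>) (Poly_Mapping.lookup (Poly_Mapping.lookup x \<sigma>) u))
      \<subseteq> {\<sigma>. \<sigma> \<subseteq> {..<length ms} \<and> card \<sigma> = Suc (Suc i)}"
    using \<sigma> by (auto simp: Let_def taylor_elem_def split: if_splits)
qed

theorem acyclic_taylor:
  "acyclic_complex mpoly_ring (taylor_complex ms :: (('n::finite, 'k::field) mpoly, _) module_complex)"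
  unfolding acyclic_complex_def
proof (intro conjI allI chain_complex_taylor equalityI subsetI)
  fix i and x :: "nat set \<Rightarrow>\<^sub>0 ('n, 'k) mpoly"
  assume "x \<in> a_kernel (chain (taylor_complex ms) (Suc i)) (chain (taylor_complex ms) i) (bdry (taylor_complex ms) (Suc i))"
  then have x: "Poly_Mapping.keys x \<subseteq> {\<sigma>. \<sigma> \<subseteq> {..<length ms} \<and> card \<sigma> = Suc i}"
    and 0: "lin_ext (taylor_bdry_basis ms) x = 0"
    by (auto simp: a_kernel_def')
  have "x = lin_ext (taylor_bdry_basis ms) (taylor_homotopy ms x)"
    using taylor_homotopy_eq[OF x] by (simp add: 0 additive.zero[OF additive_taylor_homotopy])
  with keys_taylor_homotopy[OF x]
  show "x \<in> bdry (taylor_complex ms) (Suc (Suc i)) ` carrier (chain (taylor_complex ms) (Suc (Suc i)))"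
    by (auto intro!: image_eqI)
next
  fix i and x :: "nat set \<Rightarrow>\<^sub>0 ('n, 'k) mpoly"
  assume "x \<in> bdry (taylor_complex ms) (Suc (Suc i)) ` carrier (chain (taylor_complex ms) (Suc (Suc i)))"
  with chain_complex_taylor[of ms]
  show "x \<in> a_kernel (chain (taylor_complex ms) (Suc i)) (chain (taylor_complex ms) i) (bdry (taylor_complex ms) (Suc i))"
    unfolding chain_complex_def a_kernel_def' by (blast dest: linear_mapsD(1))
qed


section \<open>Reordering the generators\<close>

text \<open>Its parity is the sign picked up when the wedge of the basis vectors with indices
  \<open>\<pi> j\<close>, taken in the order of j, is sorted increasingly.\<close>

definition inversions :: "(nat \<Rightarrow> nat) \<Rightarrow> nat set \<Rightarrow> nat"
  where "inversions \<pi> \<sigma> = card {(k, l). k \<in> \<sigma> \<and> l \<in> \<sigma> \<and> k < l \<and> \<pi> l < \<pi> k}"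

text \<open>The sign condition for the relabelling to commute with the differentials. Let A and B be
  the indices forming an inversion with j, below and above it, and C those below j that form none.
  Removing j destroys |A| + |B| inversions; \<open>\<pi> j\<close> has |B| + |C| elements before it
  in the image, and j has |A| + |C| before it. Modulo 2 these add up.\<close>

lemma inversions_remove:
  assumes fin: "finite \<sigma>" and inj: "inj_on \<pi> \<sigma>" and j: "j \<in> \<sigma>"
  shows "even (inversions \<pi> \<sigma> + card {l \<in> \<pi> ` \<sigma>. l < \<pi> j}) \<longleftrightarrow>
    even (inversions \<pi> (\<sigma> - {j}) + card {l \<in> \<sigma>. l < j})"
proof -
  define A where "A = {l \<in> \<sigma>. l < j \<and> \<pi> j < \<pi> l}"
  define B where "B = {l \<in> \<sigma>. j < l \<and> \<pi> l < \<pi> j}"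
  define C where "C = {l \<in> \<sigma>. l < j \<and> \<pi> l < \<pi> j}"
  define E where "E = {(k, l). k \<in> \<sigma> - {j} \<and> l \<in> \<sigma> - {j} \<and> k < l \<and> \<pi> l < \<pi> k}"
  have "finite E"
    by (rule finite_subset[of _ "\<sigma> \<times> \<sigma>"]) (use fin in \<open>auto simp: E_def\<close>)
  then have finE: "finite E" "finite A" "finite B" "finite C"
    using fin by (auto simp: A_def B_def C_def)
  have "{(k, l). k \<in> \<sigma> \<and> l \<in> \<sigma> \<and> k < l \<and> \<pi> l < \<pi> k} = E \<union> ((\<lambda>l. (l, j)) ` A \<union> Pair j ` B)"
    using j by (auto simp: A_def B_def E_def)
  moreover have "card (E \<union> ((\<lambda>l. (l, j)) ` A \<union> Pair j ` B)) = card E + (card A + card B)"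
  proof -
    have "card ((\<lambda>l. (l, j)) ` A \<union> Pair j ` B) = card ((\<lambda>l. (l, j)) ` A) + card (Pair j ` B)"
      by (rule card_Un_disjoint[OF finite_imageI[OF finE(2)] finite_imageI[OF finE(3)]]) (auto simp: A_def B_def)
    moreover have "card ((\<lambda>l. (l, j)) ` A) = card A" "card (Pair j ` B) = card B"
      by (auto intro!: card_image simp: inj_on_def)
    moreover have "card (E \<union> ((\<lambda>l. (l, j)) ` A \<union> Pair j ` B)) = card E + card ((\<lambda>l. (l, j)) ` A \<union> Pair j ` B)"
      by (rule card_Un_disjoint[OF finE(1)]) (use finE(2,3) in simp, auto simp: E_def)
    ultimately show ?thesis
      by simp
  qed
  ultimately have 1: "inversions \<pi> \<sigma> = inversions \<pi> (\<sigma> - {j}) + (card A + card B)"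
    by (simp add: inversions_def E_def)
  have "{l \<in> \<pi> ` \<sigma>. l < \<pi> j} = \<pi> ` (B \<union> C)"
  proof (intro equalityI subsetI)
    fix m assume "m \<in> {l \<in> \<pi> ` \<sigma>. l < \<pi> j}"
    then obtain l where l: "l \<in> \<sigma>" "m = \<pi> l" "\<pi> l < \<pi> j"
      by auto
    then have "l \<in> B \<union> C"
      by (cases l j rule: linorder_cases) (auto simp: B_def C_def)
    then show "m \<in> \<pi> ` (B \<union> C)"
      using l by simp
  qed (auto simp: B_def C_def)
  moreover have "card (\<pi> ` (B \<union> C)) = card (B \<union> C)"
    by (rule card_image) (rule inj_on_subset[OF inj], auto simp: B_def C_def)
  moreover have "card (B \<union> C) = card B + card C"
    by (rule card_Un_disjoint[OF finE(3,4)]) (auto simp: B_def C_def)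
  ultimately have 2: "card {l \<in> \<pi> ` \<sigma>. l < \<pi> j} = card B + card C"
    by simp
  have "{l \<in> \<sigma>. l < j} = A \<union> C"
  proof (intro equalityI subsetI)
    fix l assume l: "l \<in> {l \<in> \<sigma>. l < j}"
    then have "\<pi> l \<noteq> \<pi> j"
      using inj_onD[OF inj, of l j] j by auto
    then show "l \<in> A \<union> C"
      using l by (auto simp: A_def C_def)
  qed (auto simp: A_def C_def)
  moreover have "card (A \<union> C) = card A + card C"
    by (rule card_Un_disjoint[OF finE(2,4)]) (auto simp: A_def C_def)
  ultimately have 3: "card {l \<in> \<sigma>. l < j} = card A + card C"
    by simp
  show ?thesis
    unfolding 1 2 3 by presburger
qed

lemma isomorphic_taylor_same_set:
  assumes "distinct ks" "distinct ls" and set: "set ks = set ls"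
  shows "isomorphic_complexes mpoly_ring
    (taylor_complex ks :: (('n::finite, 'k::field) mpoly, _) module_complex) (taylor_complex ls)"
proof -
  define n where "n = length ks"
  have n: "length ks = n" "length ls = n"
    using assms by (auto simp: n_def) (metis distinct_card)
  have bk: "bij_betw ((!) ks) {..<n} (set ks)" and bl: "bij_betw ((!) ls) {..<n} (set ks)"
    using assms n by (auto intro!: bij_betw_nth)
  \<comment> \<open>The position in \<open>ls\<close> of the generator at position i of
    \<open>ks\<close>.\<close>
  define \<pi> where "\<pi> = (\<lambda>i. inv_into {..<n} ((!) ls) (ks ! i))"
  have bij: "bij_betw \<pi> {..<n} {..<n}"
    using bij_betw_trans[OF bk bij_betw_inv_into[OF bl]] by (simp add: \<pi>_def comp_def)
  have inj: "inj_on \<pi> {..<n}"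
    using bij by (rule bij_betw_imp_inj_on)
  have nth: "ls ! \<pi> i = ks ! i" if "i < n" for i
    unfolding \<pi>_def using that by (intro bij_betw_inv_into_right[OF bl]) (simp add: n)
  define \<rho> where "\<rho> = inv_into {..<n} \<pi>"
  have lcm: "taylor_lcm ls (\<pi> ` \<sigma>) = taylor_lcm ks \<sigma>" if "\<sigma> \<subseteq> {..<n}" for \<sigma>
  proof -
    have "(\<lambda>j. ls ! j) ` \<pi> ` \<sigma> = (\<lambda>j. ks ! j) ` \<sigma>"
      unfolding image_image using that nth by (intro image_cong) auto
    then show ?thesis
      by (simp add: taylor_lcm_def)
  qed
  define F :: "nat set \<Rightarrow> (nat set \<Rightarrow>\<^sub>0 ('n, 'k) mpoly)" where
    "F \<sigma> = Poly_Mapping.single (\<pi> ` \<sigma>) ((-1) ^ inversions \<pi> \<sigma>)" for \<sigma>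
  \<comment> \<open>The sign of the preimage is reused instead of an inversion count for the inverse
    permutation, so a composite of F and G contains the same sign twice.\<close>
  define G :: "nat set \<Rightarrow> (nat set \<Rightarrow>\<^sub>0 ('n, 'k) mpoly)" where
    "G \<tau> = Poly_Mapping.single (\<rho> ` \<tau>) ((-1) ^ inversions \<pi> (\<rho> ` \<tau>))" for \<tau>
  let ?B = "\<lambda>i. {\<sigma>. \<sigma> \<subseteq> {..<n} \<and> card \<sigma> = i}"
  have \<pi>B: "\<pi> ` \<sigma> \<in> ?B i" if "\<sigma> \<in> ?B i" for \<sigma> i
    using that bij inj by (auto simp: bij_betw_def card_image inj_on_subset)
  have \<rho>: "bij_betw \<rho> {..<n} {..<n}"
    unfolding \<rho>_def using bij by (rule bij_betw_inv_into)
  have \<rho>B: "\<rho> ` \<sigma> \<in> ?B i" if "\<sigma> \<in> ?B i" for \<sigma> i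
    using that \<rho> by (auto simp: bij_betw_def card_image inj_on_subset)
  have \<rho>\<pi>: "\<rho> ` \<pi> ` \<sigma> = \<sigma>" if "\<sigma> \<in> ?B i" for \<sigma> i
    using that inj by (force simp: \<rho>_def image_iff)
  have \<pi>\<rho>: "\<pi> ` \<rho> ` \<sigma> = \<sigma>" if "\<sigma> \<in> ?B i" for \<sigma> i
    using that bij_betw_inv_into_right[OF bij] by (force simp: \<rho>_def image_iff)
  have linF: "lin_ext F \<in> linear_maps mpoly_ring (free_module (?B i)) (free_module (?B i))" for i
    using \<pi>B by (intro lin_ext_linear_maps) (auto simp: F_def)
  have linG: "lin_ext G \<in> linear_maps mpoly_ring (free_module (?B i)) (free_module (?B i))" for i
    using \<rho>B by (intro lin_ext_linear_maps) (auto simp: G_def)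
  have sign: "(-1) ^ m * (-1) ^ m = (1 :: ('n, 'k) mpoly)" for m
    by (simp flip: power_mult_distrib)
  have GF: "lin_ext G (lin_ext F x) = x" if "Poly_Mapping.keys x \<subseteq> ?B i" for x i
  proof -
    have "lin_ext G (lin_ext F x) = lin_ext (\<lambda>\<sigma>. Poly_Mapping.single \<sigma> 1) x"
      unfolding lin_ext_lin_ext
    proof (rule lin_ext_cong)
      fix \<sigma> assume "\<sigma> \<in> Poly_Mapping.keys x"
      with that have "\<rho> ` \<pi> ` \<sigma> = \<sigma>"
        by (intro \<rho>\<pi>[of \<sigma> i]) blast
      then show "lin_ext G (F \<sigma>) = Poly_Mapping.single \<sigma> 1"
        by (simp add: F_def G_def sign)
    qed
    then show ?thesis
      by (simp add: lin_ext_basis)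
  qed
  have FG: "lin_ext F (lin_ext G x) = x" if "Poly_Mapping.keys x \<subseteq> ?B i" for x i
  proof -
    have "lin_ext F (lin_ext G x) = lin_ext (\<lambda>\<sigma>. Poly_Mapping.single \<sigma> 1) x"
      unfolding lin_ext_lin_ext
    proof (rule lin_ext_cong)
      fix \<sigma> assume "\<sigma> \<in> Poly_Mapping.keys x"
      with that have "\<pi> ` \<rho> ` \<sigma> = \<sigma>"
        by (intro \<pi>\<rho>[of \<sigma> i]) blast
      then show "lin_ext F (G \<sigma>) = Poly_Mapping.single \<sigma> 1"
        by (simp add: F_def G_def sign)
    qed
    then show ?thesis
      by (simp add: lin_ext_basis)
  qed
  have bijF: "bij_betw (lin_ext F) (carrier (free_module (?B i))) (carrier (free_module (?B i)))" for i
    using linear_mapsD(1)[OF linF[of i]] linear_mapsD(1)[OF linG[of i]] GF FG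
    by (intro bij_betwI[where g = "lin_ext G"]) auto
  have comm: "lin_ext F (taylor_bdry_basis ks \<sigma>) = lin_ext (taylor_bdry_basis ls) (F \<sigma>)"
    if \<sigma>: "\<sigma> \<subseteq> {..<n}" for \<sigma>
  proof -
    have fin: "finite \<sigma>" and inj\<sigma>: "inj_on \<pi> \<sigma>"
      using \<sigma> inj by (auto intro: finite_subset inj_on_subset)
    have "lin_ext (taylor_bdry_basis ls) (F \<sigma>) = (\<Sum>j\<in>\<sigma>. Poly_Mapping.single (\<pi> ` \<sigma> - {\<pi> j})
       ((-1) ^ inversions \<pi> \<sigma> * ((-1) ^ card {l \<in> \<pi> ` \<sigma>. l < \<pi> j} *
         monomial (taylor_lcm ls (\<pi> ` \<sigma>) - taylor_lcm ls (\<pi> ` \<sigma> - {\<pi> j})))))"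
      by (simp add: F_def taylor_bdry_basis_def sum.reindex[OF inj\<sigma>] scale_sum)
    also have "\<dots> = lin_ext F (taylor_bdry_basis ks \<sigma>)"
      unfolding lin_ext_taylor_bdry_basis
    proof (intro sum.cong refl)
      fix j assume j: "j \<in> \<sigma>"
      have remove: "\<pi> ` \<sigma> - {\<pi> j} = \<pi> ` (\<sigma> - {j})"
        using inj\<sigma> j by (auto simp: inj_on_def)
      have lcm': "taylor_lcm ls (\<pi> ` (\<sigma> - {j})) = taylor_lcm ks (\<sigma> - {j})"
        using \<sigma> by (intro lcm) auto
      have sgn: "(-1) ^ inversions \<pi> \<sigma> * (-1) ^ card {l \<in> \<pi> ` \<sigma>. l < \<pi> j} =
          (-1) ^ card {l \<in> \<sigma>. l < j} * (-1 :: ('n, 'k) mpoly) ^ inversions \<pi> (\<sigma> - {j})"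
        using inversions_remove[OF fin inj\<sigma> j]
        by (simp only: power_add[symmetric]) (simp only: minus_one_power_iff add.commute[of "card {l \<in> \<sigma>. l < j}"])
      show "Poly_Mapping.single (\<pi> ` \<sigma> - {\<pi> j})
         ((-1) ^ inversions \<pi> \<sigma> * ((-1) ^ card {l \<in> \<pi> ` \<sigma>. l < \<pi> j} *
         monomial (taylor_lcm ls (\<pi> ` \<sigma>) - taylor_lcm ls (\<pi> ` \<sigma> - {\<pi> j})))) =
         scale ((-1) ^ card {l \<in> \<sigma>. l < j} * monomial (taylor_lcm ks \<sigma> - taylor_lcm ks (\<sigma> - {j}))) (F (\<sigma> - {j}))"
        unfolding remove lcm' lcm[OF \<sigma>] F_def scale_single mult.assoc[symmetric] sgn
        by (simp only: mult.assoc mult.commute[of "monomial _"])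
    qed
    finally show ?thesis ..
  qed
  show ?thesis
    unfolding isomorphic_complexes_def taylor_complex_simps n
  proof (intro conjI exI[of _ "\<lambda>_. lin_ext F"] allI chain_complex_taylor linF bijF ballI)
    fix i and x :: "nat set \<Rightarrow>\<^sub>0 ('n, 'k) mpoly"
    assume "x \<in> carrier (free_module (?B (Suc i)))"
    then show "lin_ext F (lin_ext (taylor_bdry_basis ks) x) = lin_ext (taylor_bdry_basis ls) (lin_ext F x)"
      unfolding lin_ext_lin_ext by (intro lin_ext_cong comm) auto
  qed
qed


section \<open>Tensor products of free modules\<close>

text \<open>The index of the basis vector \<open>b \<otimes> c\<close> is \<open>\<kappa> b c\<close> rather
  than the pair \<open>(b, c)\<close>, so that the union of index sets can be used for Taylor complexes.\<close>

definition tens :: "('b \<Rightarrow> 'c \<Rightarrow> 'd) \<Rightarrow> ('b \<Rightarrow>\<^sub>0 'r) \<Rightarrow> ('c \<Rightarrow>\<^sub>0 'r::comm_ring_1) \<Rightarrow> ('d \<Rightarrow>\<^sub>0 'r)"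
  where "tens \<kappa> m n = lin_ext (\<lambda>b. lin_ext (\<lambda>c. Poly_Mapping.single (\<kappa> b c) 1) n) m"

lemma tens_single [simp]:
  "tens \<kappa> (Poly_Mapping.single b r) (Poly_Mapping.single c s) = Poly_Mapping.single (\<kappa> b c) (r * s)"
  by (simp add: tens_def)

lemma tens_add_left: "tens \<kappa> (m + m') n = tens \<kappa> m n + tens \<kappa> m' n"
  by (simp add: tens_def lin_ext_add)

lemma tens_add_right: "tens \<kappa> m (n + n') = tens \<kappa> m n + tens \<kappa> m n'"
  by (simp add: tens_def lin_ext_add lin_ext_add_fun)

lemma tens_scale_left: "tens \<kappa> (scale r m) n = scale r (tens \<kappa> m n)"
  by (simp add: tens_def lin_ext_scale)

lemma tens_scale_right: "tens \<kappa> m (scale r n) = scale r (tens \<kappa> m n)"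
  by (simp add: tens_def lin_ext_scale lin_ext_scale_fun)

lemma tens_lin_ext_left: "tens \<kappa> (lin_ext f m) n = lin_ext (\<lambda>b. tens \<kappa> (f b) n) m"
  by (simp add: tens_def lin_ext_lin_ext)

lemma tens_lin_ext_right: "tens \<kappa> m (lin_ext g n) = lin_ext (\<lambda>c. tens \<kappa> m (g c)) n"
proof (rule additive_eq_on_keys[where x = n])
  show "additive (\<lambda>n. tens \<kappa> m (lin_ext g n))"
    by (simp add: additive_def lin_ext_add tens_add_right)
qed (simp_all add: additive_lin_ext tens_scale_right)

text \<open>Recognises a linear map on joined indices as f \<otimes> g from its values on pairs of
  basis vectors. The restriction to B and C matters since \<open>join\<close> is undone only when
  its left part lies below the offset.\<close>

lemma lin_ext_tens:
  assumes "Poly_Mapping.keys m \<subseteq> B" "Poly_Mapping.keys n \<subseteq> C"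
    and "\<And>b c. b \<in> B \<Longrightarrow> c \<in> C \<Longrightarrow> h (\<kappa> b c) = tens \<kappa>' (f b) (g c)"
  shows "lin_ext h (tens \<kappa> m n) = tens \<kappa>' (lin_ext f m) (lin_ext g n)"
proof -
  have "lin_ext h (tens \<kappa> m n) = lin_ext (\<lambda>b. lin_ext (\<lambda>c. h (\<kappa> b c)) n) m"
    by (simp add: tens_def lin_ext_lin_ext)
  also have "\<dots> = lin_ext (\<lambda>b. lin_ext (\<lambda>c. tens \<kappa>' (f b) (g c)) n) m"
    using assms by (intro lin_ext_cong) auto
  also have "\<dots> = tens \<kappa>' (lin_ext f m) (lin_ext g n)"
    by (subst tens_lin_ext_left) (simp only: tens_lin_ext_right)
  finally show ?thesis .
qed

lemma keys_tens:
  fixes m :: "'b \<Rightarrow>\<^sub>0 'r::comm_ring_1" and n :: "'c \<Rightarrow>\<^sub>0 'r"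
  assumes "Poly_Mapping.keys m \<subseteq> B" "Poly_Mapping.keys n \<subseteq> C"
  shows "Poly_Mapping.keys (tens \<kappa> m n) \<subseteq> case_prod \<kappa> ` (B \<times> C)"
  unfolding tens_def
proof (intro keys_lin_ext)
  fix b c assume "b \<in> Poly_Mapping.keys m" "c \<in> Poly_Mapping.keys n"
  then show "Poly_Mapping.keys (Poly_Mapping.single (\<kappa> b c) (1 :: 'r)) \<subseteq> case_prod \<kappa> ` (B \<times> C)"
    using assms by auto
qed


text \<open>The homomorphism on formal sums induced by the bilinear map \<open>tens\<close>. For
  injective \<open>\<kappa>\<close> on finite bases its kernel is \<open>tensor_null\<close>, see
  \<open>null_eq_fiber\<close>.\<close>

definition tensor_eval ::
    "('b \<Rightarrow> 'c \<Rightarrow> 'd) \<Rightarrow> (('b \<Rightarrow>\<^sub>0 'r) \<times> ('c \<Rightarrow>\<^sub>0 'r) \<Rightarrow>\<^sub>0 int) \<Rightarrow> ('d \<Rightarrow>\<^sub>0 'r::comm_ring_1)"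
  where "tensor_eval \<kappa> = sum_ext (\<lambda>p k. scale (of_int k) (tens \<kappa> (fst p) (snd p)))"

lemma additive_tensor_eval: "additive (tensor_eval \<kappa>)"
  unfolding tensor_eval_def
  by (intro additive_sum_ext) (simp add: additive_def scale_add_left)

lemmas tensor_eval_add = additive.add[OF additive_tensor_eval]
  and tensor_eval_diff = additive.diff[OF additive_tensor_eval]
  and tensor_eval_minus = additive.minus[OF additive_tensor_eval]
  and tensor_eval_sum = additive.sum[OF additive_tensor_eval]
  and tensor_eval_zero = additive.zero[OF additive_tensor_eval]

lemma tensor_eval_frag_of [simp]: "tensor_eval \<kappa> (frag_of (m, n)) = tens \<kappa> m n"
  by (simp add: tensor_eval_def)

lemma keys_sum_single_eq:
  assumes "finite B" "Poly_Mapping.keys x \<subseteq> B"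
  shows "x = (\<Sum>b\<in>B. Poly_Mapping.single b (Poly_Mapping.lookup x b))"
  using assms(2)
  by (intro poly_mapping_eqI)
    (auto simp: lookup_sum lookup_single when_def assms(1) in_keys_iff)

section \<open>Cosets in the tensor product of two free modules\<close>

locale free_tensor =
  fixes B :: "'b set" and C :: "'c set" and \<kappa> :: "'b \<Rightarrow> 'c \<Rightarrow> 'd"
    and R :: "'r::comm_ring_1 ring" and M :: "('r, 'b \<Rightarrow>\<^sub>0 'r) module" and N :: "('r, 'c \<Rightarrow>\<^sub>0 'r) module"
  assumes finite_left: "finite B" and finite_right: "finite C"
    and inj: "inj_on (case_prod \<kappa>) (B \<times> C)"
  defines "R \<equiv> ring_of_type_algebra" and "M \<equiv> free_module B" and "N \<equiv> free_module C"
begin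

definition gens :: "(('b \<Rightarrow>\<^sub>0 'r) \<times> ('c \<Rightarrow>\<^sub>0 'r)) set"
  where "gens = carrier M \<times> carrier N"

definition target :: "('d \<Rightarrow>\<^sub>0 'r) set"
  where "target = {y. Poly_Mapping.keys y \<subseteq> case_prod \<kappa> ` (B \<times> C)}"

text \<open>The cosets of \<open>tensor_null\<close> are exactly these fibers, because every \<open>z\<close> is
  congruent to \<open>lift (tensor_eval \<kappa> z)\<close>.\<close>

definition fiber :: "('d \<Rightarrow>\<^sub>0 'r) \<Rightarrow> (('b \<Rightarrow>\<^sub>0 'r) \<times> ('c \<Rightarrow>\<^sub>0 'r) \<Rightarrow>\<^sub>0 int) set"
  where "fiber y = {z. Poly_Mapping.keys z \<subseteq> gens \<and> tensor_eval \<kappa> z = y}"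

text \<open>A chosen representative of a coset: every coefficient is stored in the left factor, and
  the right factor is a bare basis vector.\<close>

definition lift :: "('d \<Rightarrow>\<^sub>0 'r) \<Rightarrow> (('b \<Rightarrow>\<^sub>0 'r) \<times> ('c \<Rightarrow>\<^sub>0 'r) \<Rightarrow>\<^sub>0 int)"
  where "lift y = (\<Sum>b\<in>B. \<Sum>c\<in>C.
    frag_of (Poly_Mapping.single b (Poly_Mapping.lookup y (\<kappa> b c)), Poly_Mapping.single c 1))"

lemma gens_iff: "(m, n) \<in> gens \<longleftrightarrow> Poly_Mapping.keys m \<subseteq> B \<and> Poly_Mapping.keys n \<subseteq> C"
  by (simp add: gens_def M_def N_def)

lemma keys_lift: "Poly_Mapping.keys (lift y) \<subseteq> gens"
  unfolding lift_def by (intro keys_sum_subset) (auto simp: gens_iff)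

lemma tensor_eval_lift:
  assumes "y \<in> target"
  shows "tensor_eval \<kappa> (lift y) = y"
proof -
  have "tensor_eval \<kappa> (lift y) =
      (\<Sum>(b, c)\<in>B \<times> C. Poly_Mapping.single (\<kappa> b c) (Poly_Mapping.lookup y (\<kappa> b c)))"
    by (auto simp: lift_def tensor_eval_sum sum.cartesian_product intro!: sum.cong)
  also have "\<dots> = (\<Sum>d\<in>case_prod \<kappa> ` (B \<times> C). Poly_Mapping.single d (Poly_Mapping.lookup y d))"
    by (subst sum.reindex[OF inj]) (simp add: comp_def case_prod_unfold)
  also have "\<dots> = y"
    by (rule keys_sum_single_eq[symmetric]) (use assms finite_left finite_right in \<open>auto simp: target_def\<close>)
  finally show ?thesis .
qed

lemma lift_in_fiber: "y \<in> target \<Longrightarrow> lift y \<in> fiber y"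
  by (simp add: fiber_def keys_lift tensor_eval_lift)

lemma tensor_eval_in_target:
  "Poly_Mapping.keys z \<subseteq> gens \<Longrightarrow> tensor_eval \<kappa> z \<in> target"
proof (induction z rule: free_Abelian_group_induct[consumes 1, case_names zero diff frag])
  case (diff x y)
  then show ?case
    using keys_diff[of "tensor_eval \<kappa> x" "tensor_eval \<kappa> y"] by (auto simp: target_def tensor_eval_diff)
next
  case (frag a)
  then show ?case
    using keys_tens[of "fst a" B "snd a" C \<kappa>] by (cases a) (simp add: gens_iff target_def)
qed (simp add: tensor_eval_zero target_def)

abbreviation "null \<equiv> tensor_null R M N"

lemma relations_subset: "tensor_relations R M N \<subseteq> carrier (free_Abelian_group gens)"
proof -
  have *: "Poly_Mapping.keys (a - b) \<subseteq> S" if "Poly_Mapping.keys a \<subseteq> S" "Poly_Mapping.keys b \<subseteq> S"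
    for a b :: "('b \<Rightarrow>\<^sub>0 'r) \<times> ('c \<Rightarrow>\<^sub>0 'r) \<Rightarrow>\<^sub>0 int" and S
    using keys_diff[of a b] that by blast
  have "Poly_Mapping.keys (m + m') \<subseteq> B" if "Poly_Mapping.keys m \<subseteq> B" "Poly_Mapping.keys m' \<subseteq> B"
    for m m' :: "'b \<Rightarrow>\<^sub>0 'r"
    using keys_add[of m m'] that by blast
  moreover have "Poly_Mapping.keys (n + n') \<subseteq> C" if "Poly_Mapping.keys n \<subseteq> C" "Poly_Mapping.keys n' \<subseteq> C"
    for n n' :: "'c \<Rightarrow>\<^sub>0 'r"
    using keys_add[of n n'] that by blast
  moreover have "Poly_Mapping.keys (scale r m) \<subseteq> B" if "Poly_Mapping.keys m \<subseteq> B" for r and m :: "'b \<Rightarrow>\<^sub>0 'r"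
    using keys_scale[of r m] that by blast
  moreover have "Poly_Mapping.keys (scale r n) \<subseteq> C" if "Poly_Mapping.keys n \<subseteq> C" for r and n :: "'c \<Rightarrow>\<^sub>0 'r"
    using keys_scale[of r n] that by blast
  ultimately show ?thesis
    unfolding tensor_relations_def
    by (safe; unfold carrier_free_Abelian_group_iff; intro *; simp add: gens_iff M_def N_def)
qed

lemma subgroup_null: "subgroup null (free_Abelian_group gens)"
  unfolding tensor_null_def gens_def[symmetric]
  by (rule group.generate_is_subgroup[OF group_free_Abelian_group relations_subset])

lemma null_keys: "x \<in> null \<Longrightarrow> Poly_Mapping.keys x \<subseteq> gens"
  using subgroup.mem_carrier[OF subgroup_null] by simp

lemma null_zero: "0 \<in> null"
  using subgroup.one_closed[OF subgroup_null] by simp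

lemma null_add: "x \<in> null \<Longrightarrow> y \<in> null \<Longrightarrow> x + y \<in> null"
  using subgroup.m_closed[OF subgroup_null] by simp

lemma null_minus: "x \<in> null \<Longrightarrow> - x \<in> null"
  using subgroup.m_inv_closed[OF subgroup_null, of x] by (simp add: null_keys)

lemma null_diff: "x \<in> null \<Longrightarrow> y \<in> null \<Longrightarrow> x - y \<in> null"
  using null_add[OF _ null_minus, of x y] by simp

lemma null_sum: "(\<And>i. i \<in> A \<Longrightarrow> f i \<in> null) \<Longrightarrow> (\<Sum>i\<in>A. f i) \<in> null"
  by (induction A rule: infinite_finite_induct) (auto intro: null_zero null_add)

lemma null_trans: "x - y \<in> null \<Longrightarrow> y - z \<in> null \<Longrightarrow> x - z \<in> null"
  using null_add[of "x - y" "y - z"] by simp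

lemma null_relation: "x \<in> tensor_relations R M N \<Longrightarrow> x \<in> null"
  unfolding tensor_null_def by (rule generate.incl)

lemma null_add_left:
  assumes "Poly_Mapping.keys m \<subseteq> B" "Poly_Mapping.keys m' \<subseteq> B" "Poly_Mapping.keys n \<subseteq> C"
  shows "frag_of (m + m', n) - frag_of (m, n) - frag_of (m', n) \<in> null"
  using assms unfolding M_def N_def
  by (intro null_relation[unfolded M_def N_def])
    (simp add: tensor_relations_def, blast)

lemma null_add_right:
  assumes "Poly_Mapping.keys m \<subseteq> B" "Poly_Mapping.keys n \<subseteq> C" "Poly_Mapping.keys n' \<subseteq> C"
  shows "frag_of (m, n + n') - frag_of (m, n) - frag_of (m, n') \<in> null"
  using assms unfolding M_def N_def
  by (intro null_relation[unfolded M_def N_def])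
    (simp add: tensor_relations_def, blast)

lemma null_scale:
  assumes "Poly_Mapping.keys m \<subseteq> B" "Poly_Mapping.keys n \<subseteq> C"
  shows "frag_of (scale r m, n) - frag_of (m, scale r n) \<in> null"
  using assms unfolding M_def N_def R_def
  by (intro null_relation[unfolded M_def N_def R_def])
    (simp add: tensor_relations_def, blast)

lemma null_zero_left: "Poly_Mapping.keys n \<subseteq> C \<Longrightarrow> frag_of (0, n) \<in> null"
  using null_minus[OF null_add_left[of 0 0 n]] by simp

lemma null_zero_right: "Poly_Mapping.keys m \<subseteq> B \<Longrightarrow> frag_of (m, 0) \<in> null"
  using null_minus[OF null_add_right[of m 0 0]] by simp

lemma null_sum_left:
  assumes "finite A" "\<And>i. i \<in> A \<Longrightarrow> Poly_Mapping.keys (f i) \<subseteq> B" "Poly_Mapping.keys n \<subseteq> C"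
  shows "frag_of (\<Sum>i\<in>A. f i, n) - (\<Sum>i\<in>A. frag_of (f i, n)) \<in> null"
  using assms(1,2)
proof (induction A)
  case (insert a A)
  have "frag_of (f a + (\<Sum>i\<in>A. f i), n) - frag_of (f a, n) - frag_of (\<Sum>i\<in>A. f i, n) \<in> null"
    by (intro null_add_left keys_sum_subset assms insert.prems) auto
  moreover have "frag_of (\<Sum>i\<in>A. f i, n) - (\<Sum>i\<in>A. frag_of (f i, n)) \<in> null"
    using insert by auto
  ultimately show ?case
    using insert.hyps null_add by (fastforce simp: algebra_simps)
qed (simp add: null_zero_left assms)

lemma null_sum_right:
  assumes "finite A" "\<And>i. i \<in> A \<Longrightarrow> Poly_Mapping.keys (f i) \<subseteq> C" "Poly_Mapping.keys m \<subseteq> B"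
  shows "frag_of (m, \<Sum>i\<in>A. f i) - (\<Sum>i\<in>A. frag_of (m, f i)) \<in> null"
  using assms(1,2)
proof (induction A)
  case (insert a A)
  have "frag_of (m, f a + (\<Sum>i\<in>A. f i)) - frag_of (m, f a) - frag_of (m, \<Sum>i\<in>A. f i) \<in> null"
    by (intro null_add_right keys_sum_subset assms insert.prems) auto
  moreover have "frag_of (m, \<Sum>i\<in>A. f i) - (\<Sum>i\<in>A. frag_of (m, f i)) \<in> null"
    using insert by auto
  ultimately show ?case
    using insert.hyps null_add by (fastforce simp: algebra_simps)
qed (simp add: null_zero_right assms)

text \<open>By injectivity of \<open>\<kappa>\<close> only one pair of basis vectors contributes to
  a given joined index.\<close>

lemma lookup_tens:
  assumes "Poly_Mapping.keys m \<subseteq> B" "Poly_Mapping.keys n \<subseteq> C" "b \<in> B" "c \<in> C"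
  shows "Poly_Mapping.lookup (tens \<kappa> m n) (\<kappa> b c) = Poly_Mapping.lookup m b * Poly_Mapping.lookup n c"
proof -
  have eq: "\<kappa> b' c' = \<kappa> b c \<longleftrightarrow> b' = b \<and> c' = c" if "b' \<in> B" "c' \<in> C" for b' c'
    using inj_onD[OF inj, of "(b', c')" "(b, c)"] that assms by auto
  have "tens \<kappa> m n = (\<Sum>b'\<in>B. \<Sum>c'\<in>C.
      Poly_Mapping.single (\<kappa> b' c') (Poly_Mapping.lookup m b' * Poly_Mapping.lookup n c'))"
    unfolding tens_def lin_ext_def
    by (subst sum_ext_eq_sum[OF finite_left assms(1)], simp,
      subst sum_ext_eq_sum[OF finite_right assms(2)], simp, simp add: scale_sum)
  then have "Poly_Mapping.lookup (tens \<kappa> m n) (\<kappa> b c) = (\<Sum>b'\<in>B. \<Sum>c'\<in>C.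
      if c' = c then if b' = b then Poly_Mapping.lookup m b' * Poly_Mapping.lookup n c' else 0 else 0)"
    by (simp add: lookup_sum lookup_single when_def) (intro sum.cong refl, simp add: eq)
  then show ?thesis
    using assms by (simp add: finite_left finite_right)
qed

text \<open>Modulo \<open>null\<close> the lift is additive, so a single pair (m, n) suffices. Both
  entries are expanded in basis vectors, and the scalar relation moves the coefficient of n into the
  left factor, where \<open>lift\<close> keeps it.\<close>

lemma diff_lift_null: "Poly_Mapping.keys z \<subseteq> gens \<Longrightarrow> z - lift (tensor_eval \<kappa> z) \<in> null"
proof (induction z rule: free_Abelian_group_induct[consumes 1, case_names zero diff frag])
  case zero
  have "lift 0 \<in> null"
    unfolding lift_def by (intro null_sum) (simp add: null_zero_left)
  then show ?case
    using null_minus by (simp add: tensor_eval_zero)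
next
  case (diff x y)
  let ?x = "tensor_eval \<kappa> x" and ?y = "tensor_eval \<kappa> y"
  \<comment> \<open>As formal sums, the symbol (a + b, e) differs from the sum of (a, e) and (b, e),
    so additivity of \<open>lift\<close> holds only up to relations.\<close>
  have "lift ?x - lift (?x - ?y) - lift ?y \<in> null"
    unfolding lift_def sum_subtractf[symmetric]
  proof (intro null_sum)
    fix b c assume bc: "b \<in> B" "c \<in> C"
    let ?d = "\<kappa> b c"
    have "Poly_Mapping.single b (Poly_Mapping.lookup ?x ?d) = Poly_Mapping.single b (Poly_Mapping.lookup (?x - ?y) ?d) +
        Poly_Mapping.single b (Poly_Mapping.lookup ?y ?d)"
      by (simp add: lookup_minus flip: single_add)
    then show "frag_of (Poly_Mapping.single b (Poly_Mapping.lookup ?x ?d), Poly_Mapping.single c 1) -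
        frag_of (Poly_Mapping.single b (Poly_Mapping.lookup (?x - ?y) ?d), Poly_Mapping.single c 1) -
        frag_of (Poly_Mapping.single b (Poly_Mapping.lookup ?y ?d), Poly_Mapping.single c 1) \<in> null"
      using bc by (simp only:) (intro null_add_left, auto)
  qed
  from null_add[OF this null_diff[OF diff(3,4)]] show ?case
    by (simp add: tensor_eval_diff algebra_simps)
next
  case (frag a)
  obtain m n where a: "a = (m, n)"
    by (cases a)
  have m: "Poly_Mapping.keys m \<subseteq> B" and n: "Poly_Mapping.keys n \<subseteq> C"
    using frag by (auto simp: a gens_iff)
  let ?m = "\<lambda>b. Poly_Mapping.single b (Poly_Mapping.lookup m b)"
  let ?n = "\<lambda>c. Poly_Mapping.single c (Poly_Mapping.lookup n c)"
  have 1: "frag_of (m, n) - (\<Sum>b\<in>B. frag_of (?m b, n)) \<in> null"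
    by (subst keys_sum_single_eq[OF finite_left m], rule null_sum_left)
      (auto simp: finite_left n split: if_splits)
  have 2: "(\<Sum>b\<in>B. frag_of (?m b, n)) - (\<Sum>b\<in>B. \<Sum>c\<in>C. frag_of (?m b, ?n c)) \<in> null"
    unfolding sum_subtractf[symmetric]
  proof (rule null_sum)
    fix b assume "b \<in> B"
    then show "frag_of (?m b, n) - (\<Sum>c\<in>C. frag_of (?m b, ?n c)) \<in> null"
      by (subst keys_sum_single_eq[OF finite_right n], intro null_sum_right)
        (auto simp: finite_right split: if_splits)
  qed
  have "(\<Sum>b\<in>B. \<Sum>c\<in>C. frag_of (?m b, ?n c)) - lift (tens \<kappa> m n) \<in> null"
    unfolding lift_def sum_subtractf[symmetric]
  proof (intro null_sum)
    fix b c assume bc: "b \<in> B" "c \<in> C"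
    have "frag_of (scale (Poly_Mapping.lookup n c) (?m b), Poly_Mapping.single c 1) -
        frag_of (?m b, scale (Poly_Mapping.lookup n c) (Poly_Mapping.single c 1)) \<in> null"
      using bc by (intro null_scale) (auto split: if_splits)
    from null_minus[OF this]
    show "frag_of (?m b, ?n c) - frag_of (Poly_Mapping.single b (Poly_Mapping.lookup (tens \<kappa> m n) (\<kappa> b c)),
        Poly_Mapping.single c 1) \<in> null"
      using bc by (simp add: lookup_tens m n mult.commute)
  qed
  with 1 2 show ?case
    unfolding a tensor_eval_frag_of by (blast intro: null_trans)
qed

lemma null_eq_fiber: "null = fiber 0"
proof (intro equalityI subsetI)
  fix z assume z: "z \<in> null"
  then have "z \<in> generate (free_Abelian_group gens) (tensor_relations R M N)"
    by (simp add: tensor_null_def gens_def)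
  then have "tensor_eval \<kappa> z = 0"
  proof induction
    case (incl h)
    then show ?case
      by (auto simp: tensor_relations_def tensor_eval_diff tens_add_left tens_add_right
          tens_scale_left tens_scale_right M_def N_def)
  next
    case (inv h)
    moreover from inv have "Poly_Mapping.keys h \<subseteq> gens"
      using subsetD[OF relations_subset] by simp
    ultimately show ?case
      by (auto simp: tensor_relations_def tensor_eval_diff tens_add_left tens_add_right
          tens_scale_left tens_scale_right M_def N_def tensor_eval_minus)
  qed (simp_all add: tensor_eval_zero tensor_eval_add)
  then show "z \<in> fiber 0"
    using null_keys[OF z] by (simp add: fiber_def)
next
  fix z assume "z \<in> fiber 0"
  then have "z - lift 0 \<in> null"
    using diff_lift_null[of z] by (simp add: fiber_def)
  \<comment> \<open>In general \<open>lift 0\<close> is not the zero formal sum, being made of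
    symbols (0, e); this instance shows that it is null.\<close>
  moreover have "0 - lift 0 \<in> null"
    using diff_lift_null[of 0] by (simp add: tensor_eval_zero)
  ultimately show "z \<in> null"
    using null_diff by fastforce
qed

lemma fiber_add:
  assumes "a \<in> fiber y" "b \<in> fiber y'"
  shows "a + b \<in> fiber (y + y')"
  using assms keys_add[of a b] by (auto simp: fiber_def tensor_eval_add)

lemma fiber_diff:
  assumes "a \<in> fiber y" "b \<in> fiber y'"
  shows "a - b \<in> fiber (y - y')"
  using assms keys_diff[of a b] by (auto simp: fiber_def tensor_eval_diff)

text \<open>W is allowed to be a part of a fiber because \<open>tensor_map\<close> adds
  \<open>null\<close> to an image that need not be a full coset. Subtracting one element of W
  reaches everything.\<close>

lemma fiber_set_mult:
  assumes "W \<subseteq> fiber y'" "W \<noteq> {}"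
  shows "fiber y <#>\<^bsub>free_Abelian_group gens\<^esub> W = fiber (y + y')"
proof (intro equalityI subsetI)
  fix z assume "z \<in> fiber y <#>\<^bsub>free_Abelian_group gens\<^esub> W"
  then show "z \<in> fiber (y + y')"
    using assms(1) by (auto simp: set_mult_def intro: fiber_add)
next
  fix z assume z: "z \<in> fiber (y + y')"
  obtain w where w: "w \<in> W"
    using assms(2) by auto
  with z assms(1) have "z - w \<in> fiber y"
    using fiber_diff[of z "y + y'" w y'] by auto
  with w show "z \<in> fiber y <#>\<^bsub>free_Abelian_group gens\<^esub> W"
    by (force simp: set_mult_def)
qed

lemma fiber_nonempty: "y \<in> target \<Longrightarrow> fiber y \<noteq> {}"
  using lift_in_fiber by blast

lemma fiber_inj:
  assumes "y \<in> target" "fiber y = fiber y'"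
  shows "y = y'"
proof -
  have "lift y \<in> fiber y" "lift y \<in> fiber y'"
    using lift_in_fiber[OF assms(1)] assms(2) by auto
  then show ?thesis
    by (auto simp: fiber_def)
qed

lemma coset_null:
  assumes "Poly_Mapping.keys a \<subseteq> gens"
  shows "null #>\<^bsub>free_Abelian_group gens\<^esub> a = fiber (tensor_eval \<kappa> a)"
proof -
  have "null #>\<^bsub>free_Abelian_group gens\<^esub> a = fiber 0 <#>\<^bsub>free_Abelian_group gens\<^esub> {a}"
    by (simp add: null_eq_fiber r_coset_def set_mult_def)
  also have "\<dots> = fiber (0 + tensor_eval \<kappa> a)"
    using assms by (intro fiber_set_mult) (auto simp: fiber_def)
  finally show ?thesis
    by simp
qed

lemma tensor_module_simps:
  "carrier (tensor_module R M N) = fiber ` target"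
  "\<zero>\<^bsub>tensor_module R M N\<^esub> = fiber 0"
  "y' \<in> target \<Longrightarrow> fiber y \<oplus>\<^bsub>tensor_module R M N\<^esub> fiber y' = fiber (y + y')"
  "r \<odot>\<^bsub>tensor_module R M N\<^esub> Z = tensor_map R M N (\<lambda>m. r \<odot>\<^bsub>M\<^esub> m) (\<lambda>n. n) Z"
proof -
  show "carrier (tensor_module R M N) = fiber ` target"
  proof -
    have "carrier (tensor_module R M N) = (\<lambda>a. null #>\<^bsub>free_Abelian_group gens\<^esub> a) ` {a. Poly_Mapping.keys a \<subseteq> gens}"
      by (auto simp: tensor_module_def Let_def FactGroup_def RCOSETS_def gens_def)
    also have "\<dots> = fiber ` tensor_eval \<kappa> ` {a. Poly_Mapping.keys a \<subseteq> gens}"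
      unfolding image_image by (intro image_cong) (auto simp: coset_null)
    also have "tensor_eval \<kappa> ` {a. Poly_Mapping.keys a \<subseteq> gens} = target"
      using tensor_eval_in_target tensor_eval_lift keys_lift by (auto simp: image_iff) metis
    finally show ?thesis .
  qed
  show "\<zero>\<^bsub>tensor_module R M N\<^esub> = fiber 0"
    by (simp add: tensor_module_def Let_def FactGroup_def null_eq_fiber)
  show "fiber y \<oplus>\<^bsub>tensor_module R M N\<^esub> fiber y' = fiber (y + y')" if "y' \<in> target"
    using fiber_set_mult[of "fiber y'" y' y] fiber_nonempty[OF that]
    by (simp add: tensor_module_def Let_def FactGroup_def gens_def)
qed (simp add: tensor_module_def Let_def)

end

text \<open>Naturality of evaluation, by induction over formal sums: applying f and g to the pairs
  amounts to applying \<open>\<chi>\<close> to the value. It serves for scalar multiplication and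
  for both halves of the tensor differential.\<close>

lemma tensor_map_fiber:
  fixes \<kappa> :: "'b \<Rightarrow> 'c \<Rightarrow> 'd" and \<kappa>' :: "'b2 \<Rightarrow> 'c2 \<Rightarrow> 'd2"
    and \<chi> :: "('d \<Rightarrow>\<^sub>0 'r::comm_ring_1) \<Rightarrow> ('d2 \<Rightarrow>\<^sub>0 'r)"
  assumes "free_tensor B C \<kappa>" "free_tensor B' C' \<kappa>'" and y: "y \<in> free_tensor.target B C \<kappa>"
    and f: "f \<in> carrier (free_module B) \<rightarrow> carrier (free_module B')"
    and g: "g \<in> carrier (free_module C) \<rightarrow> carrier (free_module C')"
    and \<chi>: "additive \<chi>"
    and tens: "\<And>m n. Poly_Mapping.keys m \<subseteq> B \<Longrightarrow> Poly_Mapping.keys n \<subseteq> C \<Longrightarrow>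
      \<chi> (tens \<kappa> m n) = tens \<kappa>' (f m) (g n)"
  shows "tensor_map ring_of_type_algebra (free_module B') (free_module C') f g (free_tensor.fiber B C \<kappa> y) =
    free_tensor.fiber B' C' \<kappa>' (\<chi> y)"
proof -
  interpret S: free_tensor B C \<kappa> "ring_of_type_algebra :: 'r ring" "free_module B" "free_module C"
    using assms(1) by (auto simp: free_tensor_def)
  interpret T: free_tensor B' C' \<kappa>' "ring_of_type_algebra :: 'r ring" "free_module B'" "free_module C'"
    using assms(2) by (auto simp: free_tensor_def)
  let ?\<Phi> = "frag_extend (\<lambda>(m, n). frag_of (f m, g n))"
  have fg: "(f m, g n) \<in> T.gens" if "(m, n) \<in> S.gens" for m n
    using that f g by (auto simp: S.gens_iff T.gens_iff)
  have "Poly_Mapping.keys (?\<Phi> z) \<subseteq> T.gens \<and> tensor_eval \<kappa>' (?\<Phi> z) = \<chi> (tensor_eval \<kappa> z)"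
    if "Poly_Mapping.keys z \<subseteq> S.gens" for z
    using that
  proof (induction z rule: free_Abelian_group_induct[consumes 1, case_names zero diff frag])
    case zero
    then show ?case
      by (simp add: tensor_eval_zero additive.zero[OF \<chi>])
  next
    case (diff x y)
    then show ?case
      using keys_diff[of "?\<Phi> x" "?\<Phi> y"]
      by (auto simp: frag_extend_diff tensor_eval_diff additive.diff[OF \<chi>])
  next
    case (frag a)
    then show ?case
      using fg by (cases a) (auto simp: tens S.gens_iff)
  qed
  then have "?\<Phi> ` S.fiber y \<subseteq> T.fiber (\<chi> y)"
    by (auto simp: S.fiber_def T.fiber_def)
  then have "T.fiber 0 <#>\<^bsub>free_Abelian_group T.gens\<^esub> ?\<Phi> ` S.fiber y = T.fiber (0 + \<chi> y)"
    using S.fiber_nonempty[OF y] by (intro T.fiber_set_mult) auto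
  then show ?thesis
    by (simp add: tensor_map_def T.null_eq_fiber T.gens_def)
qed


lemma tensor_complex_simps:
  "carrier (chain (tensor_complex R C D) i) =
    (\<Pi>\<^sub>E p\<in>{..i}. carrier (tensor_module R (chain C p) (chain D (i - p))))"
  "\<zero>\<^bsub>chain (tensor_complex R C D) i\<^esub> =
    (\<lambda>p\<in>{..i}. \<zero>\<^bsub>tensor_module R (chain C p) (chain D (i - p))\<^esub>)"
  "x \<oplus>\<^bsub>chain (tensor_complex R C D) i\<^esub> y =
    (\<lambda>p\<in>{..i}. x p \<oplus>\<^bsub>tensor_module R (chain C p) (chain D (i - p))\<^esub> y p)"
  "r \<odot>\<^bsub>chain (tensor_complex R C D) i\<^esub> x =
    (\<lambda>p\<in>{..i}. r \<odot>\<^bsub>tensor_module R (chain C p) (chain D (i - p))\<^esub> x p)"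
  "bdry (tensor_complex R C D) (Suc i) x = (\<lambda>p\<in>{..i}.
    tensor_map R (chain C p) (chain D (i - p)) (bdry C (p + 1)) (\<lambda>b. b) (x (p + 1))
    \<oplus>\<^bsub>tensor_module R (chain C p) (chain D (i - p))\<^esub>
    ((\<ominus>\<^bsub>R\<^esub> \<one>\<^bsub>R\<^esub>) [^]\<^bsub>R\<^esub> p) \<odot>\<^bsub>tensor_module R (chain C p) (chain D (i - p))\<^esub>
      tensor_map R (chain C p) (chain D (i - p)) (\<lambda>a. a) (bdry D (Suc i - p)) (x p))"
  by (simp_all add: tensor_complex_def Let_def)


section \<open>The Taylor complex of a concatenation\<close>

abbreviation subsets_card :: "nat \<Rightarrow> nat \<Rightarrow> nat set set"
  where "subsets_card n i \<equiv> {\<sigma>. \<sigma> \<subseteq> {..<n} \<and> card \<sigma> = i}"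

text \<open>With a the length of the first list, the shift makes the right part index the second
  half of the concatenation. The left part then precedes it, which produces the sign (-1)^p of the
  tensor differential.\<close>

definition join :: "nat \<Rightarrow> nat set \<Rightarrow> nat set \<Rightarrow> nat set"
  where "join a \<sigma> \<tau> = \<sigma> \<union> (\<lambda>j. a + j) ` \<tau>"

definition right_part :: "nat \<Rightarrow> nat set \<Rightarrow> nat set"
  where "right_part a \<rho> = {j. a + j \<in> \<rho>}"

text \<open>The basis of bidegree (p, q). The number of right indices is expressed through the
  total, which places a block visibly in homological degree p + q.\<close>

definition blocks :: "nat \<Rightarrow> nat \<Rightarrow> nat \<Rightarrow> nat \<Rightarrow> nat set set"
  where "blocks a b p q = {\<rho>. \<rho> \<subseteq> {..<a + b} \<and> card (\<rho> \<inter> {..<a}) = p \<and> card \<rho> = p + q}"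

lemma left_part_join [simp]: "\<sigma> \<subseteq> {..<a} \<Longrightarrow> join a \<sigma> \<tau> \<inter> {..<a} = \<sigma>"
  by (auto simp: join_def)

lemma right_part_join [simp]: "\<sigma> \<subseteq> {..<a} \<Longrightarrow> right_part a (join a \<sigma> \<tau>) = \<tau>"
  by (auto simp: join_def right_part_def)

lemma join_parts: "join a (\<rho> \<inter> {..<a}) (right_part a \<rho>) = \<rho>"
proof -
  have "x \<in> (\<lambda>j. a + j) ` right_part a \<rho>" if "x \<in> \<rho>" "\<not> x < a" for x
    using that by (intro image_eqI[of _ _ "x - a"]) (auto simp: right_part_def)
  then show ?thesis
    by (auto simp: join_def right_part_def)
qed

lemma card_join:
  assumes "\<sigma> \<subseteq> {..<a}" "finite \<tau>"
  shows "card (join a \<sigma> \<tau>) = card \<sigma> + card \<tau>"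
proof -
  have "finite \<sigma>"
    using assms(1) by (rule finite_subset) simp
  then have "card (join a \<sigma> \<tau>) = card \<sigma> + card ((\<lambda>j. a + j) ` \<tau>)"
    unfolding join_def using assms by (intro card_Un_disjoint) auto
  then show ?thesis
    by (simp add: card_image)
qed

lemma right_part_subset: "\<rho> \<subseteq> {..<a + b} \<Longrightarrow> right_part a \<rho> \<subseteq> {..<b}"
  by (auto simp: right_part_def)

text \<open>Turns the abstract \<open>target\<close> of the tensor product in bidegree (p, q) into a
  support condition on index sets.\<close>

lemma image_join: "case_prod (join a) ` (subsets_card a p \<times> subsets_card b q) = blocks a b p q"
proof (intro equalityI subsetI)
  fix \<rho> assume "\<rho> \<in> case_prod (join a) ` (subsets_card a p \<times> subsets_card b q)"
  then obtain \<sigma> \<tau> where *: "\<rho> = join a \<sigma> \<tau>" "\<sigma> \<subseteq> {..<a}" "card \<sigma> = p" "\<tau> \<subseteq> {..<b}" "card \<tau> = q"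
    by auto
  then have "finite \<tau>"
    by (auto intro: finite_subset)
  with * have "card \<rho> = p + q"
    by (simp add: card_join)
  with * show "\<rho> \<in> blocks a b p q"
    by (auto simp: blocks_def) (auto simp: join_def)
next
  fix \<rho> assume \<rho>: "\<rho> \<in> blocks a b p q"
  then have r: "right_part a \<rho> \<subseteq> {..<b}"
    by (auto simp: blocks_def right_part_subset)
  then have "finite (right_part a \<rho>)"
    by (rule finite_subset) simp
  then have "card \<rho> = card (\<rho> \<inter> {..<a}) + card (right_part a \<rho>)"
    using card_join[of "\<rho> \<inter> {..<a}" a "right_part a \<rho>"] by (simp add: join_parts)
  with \<rho> r show "\<rho> \<in> case_prod (join a) ` (subsets_card a p \<times> subsets_card b q)"
    by (intro image_eqI[of _ _ "(\<rho> \<inter> {..<a}, right_part a \<rho>)"]) (auto simp: join_parts blocks_def)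
qed

lemma free_tensor_join: "free_tensor (subsets_card a p) (subsets_card b q) (join a)"
proof
  show "inj_on (case_prod (join a)) (subsets_card a p \<times> subsets_card b q)"
  proof (rule inj_onI, clarify)
    fix \<sigma> \<tau> \<sigma>' \<tau>'
    assume "join a \<sigma> \<tau> = join a \<sigma>' \<tau>'" "\<sigma> \<subseteq> {..<a}" "\<sigma>' \<subseteq> {..<a}"
    then show "\<sigma> = \<sigma>' \<and> \<tau> = \<tau>'"
      by (metis left_part_join right_part_join)
  qed
qed simp_all

text \<open>Named outside the locale with numerical parameters, since the isomorphism involves all
  bidegrees at once.\<close>

definition block_fiber ::
    "nat \<Rightarrow> nat \<Rightarrow> nat \<Rightarrow> nat \<Rightarrow> (nat set \<Rightarrow>\<^sub>0 'r::comm_ring_1) \<Rightarrow> ((nat set \<Rightarrow>\<^sub>0 'r) \<times> (nat set \<Rightarrow>\<^sub>0 'r) \<Rightarrow>\<^sub>0 int) set"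
  where "block_fiber a b p q = free_tensor.fiber (subsets_card a p) (subsets_card b q) (join a)"

abbreviation block_tensor :: "nat \<Rightarrow> nat \<Rightarrow> nat \<Rightarrow> nat \<Rightarrow>
    ('r::comm_ring_1, ((nat set \<Rightarrow>\<^sub>0 'r) \<times> (nat set \<Rightarrow>\<^sub>0 'r) \<Rightarrow>\<^sub>0 int) set) module"
  where "block_tensor a b p q \<equiv>
    tensor_module ring_of_type_algebra (free_module (subsets_card a p)) (free_module (subsets_card b q))"

lemma block_target:
  "free_tensor.target (subsets_card a p) (subsets_card b q) (join a) =
    {y :: nat set \<Rightarrow>\<^sub>0 'r::comm_ring_1. Poly_Mapping.keys y \<subseteq> blocks a b p q}"
  by (simp add: free_tensor.target_def[OF free_tensor_join] image_join)

lemma block_tensor_map: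
  fixes \<chi> :: "(nat set \<Rightarrow>\<^sub>0 'r::comm_ring_1) \<Rightarrow> (nat set \<Rightarrow>\<^sub>0 'r)"
  assumes "Poly_Mapping.keys y \<subseteq> blocks a b p q"
    and "f \<in> carrier (free_module (subsets_card a p)) \<rightarrow> carrier (free_module (subsets_card a' p'))"
    and "g \<in> carrier (free_module (subsets_card b q)) \<rightarrow> carrier (free_module (subsets_card b' q'))"
    and "additive \<chi>"
    and "\<And>m n. Poly_Mapping.keys m \<subseteq> subsets_card a p \<Longrightarrow> Poly_Mapping.keys n \<subseteq> subsets_card b q \<Longrightarrow>
      \<chi> (tens (join a) m n) = tens (join a') (f m) (g n)"
  shows "tensor_map ring_of_type_algebra (free_module (subsets_card a' p')) (free_module (subsets_card b' q')) f g
    (block_fiber a b p q y) = block_fiber a' b' p' q' (\<chi> y)"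
  unfolding block_fiber_def
  by (rule tensor_map_fiber[OF free_tensor_join free_tensor_join]) (use assms in \<open>auto simp: block_target\<close>)

lemma block_tensor_simps:
  "carrier (block_tensor a b p q :: ('r::comm_ring_1, _) module) =
    block_fiber a b p q ` {y. Poly_Mapping.keys y \<subseteq> blocks a b p q}"
  "\<zero>\<^bsub>block_tensor a b p q :: ('r, _) module\<^esub> = block_fiber a b p q 0"
  "Poly_Mapping.keys y' \<subseteq> blocks a b p q \<Longrightarrow>
    block_fiber a b p q y \<oplus>\<^bsub>block_tensor a b p q\<^esub> block_fiber a b p q y' = block_fiber a b p q (y + (y' :: _ \<Rightarrow>\<^sub>0 'r))"
  "Poly_Mapping.keys y \<subseteq> blocks a b p q \<Longrightarrow>
    r \<odot>\<^bsub>block_tensor a b p q\<^esub> block_fiber a b p q y = block_fiber a b p q (scale (r :: 'r) y)"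
proof -
  interpret T: free_tensor "subsets_card a p" "subsets_card b q" "join a" "ring_of_type_algebra :: 'r ring"
    "free_module (subsets_card a p)" "free_module (subsets_card b q)"
    using free_tensor_join by (auto simp: free_tensor_def)
  show "carrier (block_tensor a b p q :: ('r, _) module) =
      block_fiber a b p q ` {y. Poly_Mapping.keys y \<subseteq> blocks a b p q}"
    by (simp add: T.tensor_module_simps block_target block_fiber_def)
  show "\<zero>\<^bsub>block_tensor a b p q :: ('r, _) module\<^esub> = block_fiber a b p q 0"
    by (simp add: T.tensor_module_simps block_fiber_def)
  show "block_fiber a b p q y \<oplus>\<^bsub>block_tensor a b p q\<^esub> block_fiber a b p q y' = block_fiber a b p q (y + y')"
    if "Poly_Mapping.keys y' \<subseteq> blocks a b p q"
    using that by (simp add: T.tensor_module_simps block_target block_fiber_def)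
  show "r \<odot>\<^bsub>block_tensor a b p q\<^esub> block_fiber a b p q y = block_fiber a b p q (scale (r :: 'r) y)"
    if "Poly_Mapping.keys y \<subseteq> blocks a b p q"
    unfolding T.tensor_module_simps free_module_simps
    by (rule block_tensor_map[OF that _ _ additive_scale])
      (use keys_scale in \<open>fastforce simp: tens_scale_left\<close>)+
qed

lemma block_fiber_inj:
  assumes "Poly_Mapping.keys y \<subseteq> blocks a b p q" "block_fiber a b p q y = block_fiber a b p q y'"
  shows "y = y'"
  using free_tensor.fiber_inj[OF free_tensor_join, of y] assms
  by (auto simp: block_fiber_def block_target)

text \<open>In homological degree i these projections, for p \<le> i, split the Taylor complex of a
  concatenation into the bidegrees (p, i - p).\<close>

definition block_proj :: "nat \<Rightarrow> nat \<Rightarrow> (nat set \<Rightarrow>\<^sub>0 'r::comm_ring_1) \<Rightarrow> (nat set \<Rightarrow>\<^sub>0 'r)"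
  where "block_proj a p = lin_ext (\<lambda>\<rho>. if card (\<rho> \<inter> {..<a}) = p then Poly_Mapping.single \<rho> 1 else 0)"

lemma block_proj_eq:
  assumes "\<And>\<rho>. \<rho> \<in> Poly_Mapping.keys x \<Longrightarrow> card (\<rho> \<inter> {..<a}) = q"
  shows "block_proj a p x = (if p = q then x else 0)"
proof -
  have "block_proj a p x = lin_ext (\<lambda>\<rho>. if p = q then Poly_Mapping.single \<rho> 1 else 0) x"
    unfolding block_proj_def using assms by (intro lin_ext_cong) auto
  then show ?thesis
    by (simp add: lin_ext_basis)
qed

lemma keys_block_proj:
  assumes "Poly_Mapping.keys y \<subseteq> subsets_card (a + b) i" "p \<le> i"
  shows "Poly_Mapping.keys (block_proj a p y) \<subseteq> blocks a b p (i - p)"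
  unfolding block_proj_def using assms by (intro keys_lin_ext) (auto simp: blocks_def)

lemma sum_block_proj:
  assumes "Poly_Mapping.keys y \<subseteq> subsets_card n i"
  shows "(\<Sum>p\<le>i. block_proj a p y) = y"
proof (rule additive_eq_on_keys[where x = y])
  show "additive (\<lambda>y. \<Sum>p\<le>i. block_proj a p y)"
    by (simp add: additive_def block_proj_def lin_ext_add sum.distrib)
next
  fix \<rho> and c :: 'a
  assume "\<rho> \<in> Poly_Mapping.keys y"
  then have "\<rho> \<subseteq> {..<n}" "card \<rho> = i"
    using assms by auto
  \<comment> \<open>The block containing \<open>\<rho>\<close> therefore occurs among those summed
    over.\<close>
  then have "card (\<rho> \<inter> {..<a}) \<le> i"
    by (metis card_mono finite_lessThan finite_subset inf_le1)
  have "(\<Sum>p\<le>i. block_proj a p (Poly_Mapping.single \<rho> c)) =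
      (\<Sum>p\<le>i. if p = card (\<rho> \<inter> {..<a}) then Poly_Mapping.single \<rho> c else 0)"
    by (intro sum.cong refl) (auto simp: block_proj_def)
  then show "(\<Sum>p\<le>i. block_proj a p (Poly_Mapping.single \<rho> c)) = Poly_Mapping.single \<rho> c"
    using \<open>card (\<rho> \<inter> {..<a}) \<le> i\<close> by simp
qed (rule additive_ident)


section \<open>Coprime lists of generators and the Leibniz rule\<close>

definition disjoint_supports :: "('n \<Rightarrow>\<^sub>0 nat) \<Rightarrow> ('n \<Rightarrow>\<^sub>0 nat) \<Rightarrow> bool"
  where "disjoint_supports s t \<longleftrightarrow> Poly_Mapping.keys s \<inter> Poly_Mapping.keys t = {}"

text \<open>The fact that coprime monomials have their product as lcm, read at one variable: one of
  the two sides contributes only zeros. The inserted 0 covers empty sets of generators.\<close>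

lemma Max_insert_0_Un:
  fixes A B :: "nat set"
  assumes "finite A" "finite B" "\<And>x y. x \<in> A \<Longrightarrow> y \<in> B \<Longrightarrow> x = 0 \<or> y = 0"
  shows "Max (insert 0 (A \<union> B)) = Max (insert 0 A) + Max (insert 0 B)"
proof -
  have *: "Max (insert 0 (A \<union> B)) = Max (insert 0 A) \<and> Max (insert 0 B) = 0"
    if "\<And>y. y \<in> B \<Longrightarrow> y = 0" for A B :: "nat set"
  proof -
    have "insert 0 (A \<union> B) = insert 0 A" "insert 0 B = {0}"
      using that by auto
    then show ?thesis
      by (simp only: Max_singleton)
  qed
  show ?thesis
  proof (cases "\<exists>x\<in>A. x \<noteq> 0")
    case True
    then have "\<And>y. y \<in> B \<Longrightarrow> y = 0"
      using assms(3) by blast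
    then show ?thesis
      using *[of B A] by simp
  next
    case False
    then show ?thesis
      using *[of A B] by (simp add: Un_commute)
  qed
qed

context
  fixes ms ns :: "('n::finite \<Rightarrow>\<^sub>0 nat) list"
  assumes disj: "\<And>m n. m \<in> set ms \<Longrightarrow> n \<in> set ns \<Longrightarrow> disjoint_supports m n"
begin

lemma taylor_lcm_join:
  assumes "\<sigma> \<subseteq> {..<length ms}" "\<tau> \<subseteq> {..<length ns}"
  shows "taylor_lcm (ms @ ns) (join (length ms) \<sigma> \<tau>) = taylor_lcm ms \<sigma> + taylor_lcm ns \<tau>"
proof (rule poly_mapping_eqI)
  fix v
  let ?f = "\<lambda>ls j. Poly_Mapping.lookup (ls ! j :: 'n \<Rightarrow>\<^sub>0 nat) v"
  have "?f (ms @ ns) ` join (length ms) \<sigma> \<tau> = ?f ms ` \<sigma> \<union> ?f ns ` \<tau>"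
    unfolding join_def image_Un image_image using assms(1)
    by (intro arg_cong2[of _ _ _ _ "(\<union>)"] image_cong) (auto simp: nth_append)
  moreover have "Max (insert 0 (?f ms ` \<sigma> \<union> ?f ns ` \<tau>)) = Max (insert 0 (?f ms ` \<sigma>)) + Max (insert 0 (?f ns ` \<tau>))"
  proof (rule Max_insert_0_Un)
    show "finite (?f ms ` \<sigma>)" "finite (?f ns ` \<tau>)"
      using assms by (auto intro: finite_subset)
    fix x y assume "x \<in> ?f ms ` \<sigma>" "y \<in> ?f ns ` \<tau>"
    then obtain j k where "j \<in> \<sigma>" "k \<in> \<tau>" "x = ?f ms j" "y = ?f ns k"
      by auto
    moreover from this have "disjoint_supports (ms ! j) (ns ! k)"
      using assms by (intro disj nth_mem) auto
    ultimately show "x = 0 \<or> y = 0"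
      by (auto simp: disjoint_supports_def disjoint_iff in_keys_iff)
  qed
  ultimately show "Poly_Mapping.lookup (taylor_lcm (ms @ ns) (join (length ms) \<sigma> \<tau>)) v =
      Poly_Mapping.lookup (taylor_lcm ms \<sigma> + taylor_lcm ns \<tau>) v"
    by (simp add: taylor_lcm_def lookup_lcm_exponents lookup_add image_image)
qed

text \<open>The Leibniz rule. When a left index is deleted, the right lcm is a common factor of both
  monomials and cancels, and symmetrically. A right index has all of \<open>\<sigma>\<close> in
  front of it, whence the sign.\<close>

lemma taylor_bdry_join:
  assumes \<sigma>: "\<sigma> \<subseteq> {..<length ms}" and \<tau>: "\<tau> \<subseteq> {..<length ns}"
  shows "taylor_bdry_basis (ms @ ns) (join (length ms) \<sigma> \<tau>) =
    tens (join (length ms)) (taylor_bdry_basis ms \<sigma>) (Poly_Mapping.single \<tau> 1) +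
    scale ((-1) ^ card \<sigma>) (tens (join (length ms)) (Poly_Mapping.single \<sigma> 1)
      (taylor_bdry_basis ns \<tau> :: _ \<Rightarrow>\<^sub>0 ('n, 'k::field) mpoly))"
proof -
  let ?a = "length ms"
  let ?\<rho> = "join ?a \<sigma> \<tau>"
  let ?term = "\<lambda>j. Poly_Mapping.single (?\<rho> - {j}) ((-1) ^ card {l\<in>?\<rho>. l < j} *
    monomial (taylor_lcm (ms @ ns) ?\<rho> - taylor_lcm (ms @ ns) (?\<rho> - {j})) :: ('n, 'k) mpoly)"
  have fin: "finite \<sigma>" "finite \<tau>"
    using \<sigma> \<tau> by (auto intro: finite_subset)
  have lcm: "taylor_lcm (ms @ ns) ?\<rho> = taylor_lcm ms \<sigma> + taylor_lcm ns \<tau>"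
    using \<sigma> \<tau> by (rule taylor_lcm_join)
  have "(\<Sum>j\<in>?\<rho>. ?term j) = (\<Sum>j\<in>\<sigma>. ?term j) + (\<Sum>j\<in>(\<lambda>j. ?a + j) ` \<tau>. ?term j)"
    unfolding join_def[of ?a \<sigma> \<tau>]
    by (rule sum.union_disjoint) (use fin \<sigma> in auto)
  also have "(\<Sum>j\<in>\<sigma>. ?term j) = tens (join ?a) (taylor_bdry_basis ms \<sigma>) (Poly_Mapping.single \<tau> 1)"
  proof -
    have "?term j = Poly_Mapping.single (join ?a (\<sigma> - {j}) \<tau>)
        ((-1) ^ card {l\<in>\<sigma>. l < j} * monomial (taylor_lcm ms \<sigma> - taylor_lcm ms (\<sigma> - {j})))"
      if "j \<in> \<sigma>" for j
    proof -
      have remove: "?\<rho> - {j} = join ?a (\<sigma> - {j}) \<tau>" and less: "{l\<in>?\<rho>. l < j} = {l\<in>\<sigma>. l < j}"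
        using that \<sigma> by (auto simp: join_def)
      have "taylor_lcm (ms @ ns) (join ?a (\<sigma> - {j}) \<tau>) = taylor_lcm ms (\<sigma> - {j}) + taylor_lcm ns \<tau>"
        using \<sigma> \<tau> by (intro taylor_lcm_join) auto
      moreover have "s + t - (u + t) = s - u" for s t u :: "'n \<Rightarrow>\<^sub>0 nat"
        by (rule poly_mapping_eqI) (simp add: lookup_add lookup_minus)
      ultimately show ?thesis
        by (simp only: remove less lcm)
    qed
    then show ?thesis
      by (simp add: taylor_bdry_basis_def[of ms] tens_def lin_ext_sum)
  qed
  also have "(\<Sum>j\<in>(\<lambda>j. ?a + j) ` \<tau>. ?term j) =
      scale ((-1) ^ card \<sigma>) (tens (join ?a) (Poly_Mapping.single \<sigma> 1) (taylor_bdry_basis ns \<tau>))"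
  proof -
    have "?term (?a + j) = Poly_Mapping.single (join ?a \<sigma> (\<tau> - {j}))
        ((-1) ^ card \<sigma> * ((-1) ^ card {l\<in>\<tau>. l < j} * monomial (taylor_lcm ns \<tau> - taylor_lcm ns (\<tau> - {j}))))"
      if "j \<in> \<tau>" for j
    proof -
      have remove: "?\<rho> - {?a + j} = join ?a \<sigma> (\<tau> - {j})" and less: "{l\<in>?\<rho>. l < ?a + j} = join ?a \<sigma> {l\<in>\<tau>. l < j}"
        using that \<sigma> by (auto simp: join_def)
      have card: "card (join ?a \<sigma> {l\<in>\<tau>. l < j}) = card \<sigma> + card {l\<in>\<tau>. l < j}"
        using \<sigma> fin by (intro card_join) auto
      have "taylor_lcm (ms @ ns) (join ?a \<sigma> (\<tau> - {j})) = taylor_lcm ms \<sigma> + taylor_lcm ns (\<tau> - {j})"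
        using \<sigma> \<tau> by (intro taylor_lcm_join) auto
      moreover have "t + s - (t + u) = s - u" for s t u :: "'n \<Rightarrow>\<^sub>0 nat"
        by (rule poly_mapping_eqI) (simp add: lookup_add lookup_minus)
      ultimately show ?thesis
        by (simp only: remove less lcm card power_add mult.assoc)
    qed
    then show ?thesis
      by (simp add: sum.reindex taylor_bdry_basis_def[of ns] tens_def lin_ext_sum scale_sum)
  qed
  finally show ?thesis
    by (simp only: taylor_bdry_basis_def[of "ms @ ns"])
qed

text \<open>This and \<open>right_bdry\<close> are d \<otimes> 1 and the unsigned 1 \<otimes> d,
  read on joined indices by cutting, differentiating one part and joining again.\<close>

definition left_bdry :: "(nat set \<Rightarrow>\<^sub>0 ('n, 'k::field) mpoly) \<Rightarrow> (nat set \<Rightarrow>\<^sub>0 ('n, 'k) mpoly)"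
  where "left_bdry = lin_ext (\<lambda>\<rho>. tens (join (length ms)) (taylor_bdry_basis ms (\<rho> \<inter> {..<length ms}))
    (Poly_Mapping.single (right_part (length ms) \<rho>) 1))"

definition right_bdry :: "(nat set \<Rightarrow>\<^sub>0 ('n, 'k::field) mpoly) \<Rightarrow> (nat set \<Rightarrow>\<^sub>0 ('n, 'k) mpoly)"
  where "right_bdry = lin_ext (\<lambda>\<rho>. tens (join (length ms)) (Poly_Mapping.single (\<rho> \<inter> {..<length ms}) 1)
    (taylor_bdry_basis ns (right_part (length ms) \<rho>)))"

lemma left_bdry_tens:
  assumes "Poly_Mapping.keys m \<subseteq> subsets_card (length ms) p" "Poly_Mapping.keys n \<subseteq> subsets_card (length ns) q"
  shows "left_bdry (tens (join (length ms)) m n) = tens (join (length ms)) (lin_ext (taylor_bdry_basis ms) m) n"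
  unfolding left_bdry_def
  by (subst lin_ext_tens[OF assms, where \<kappa>' = "join (length ms)" and f = "taylor_bdry_basis ms"
        and g = "\<lambda>c. Poly_Mapping.single c 1"])
    (simp_all add: lin_ext_basis)

lemma right_bdry_tens:
  assumes "Poly_Mapping.keys m \<subseteq> subsets_card (length ms) p" "Poly_Mapping.keys n \<subseteq> subsets_card (length ns) q"
  shows "right_bdry (tens (join (length ms)) m n) = tens (join (length ms)) m (lin_ext (taylor_bdry_basis ns) n)"
  unfolding right_bdry_def
  by (subst lin_ext_tens[OF assms, where \<kappa>' = "join (length ms)" and g = "taylor_bdry_basis ns"
        and f = "\<lambda>c. Poly_Mapping.single c 1"])
    (simp_all add: lin_ext_basis)

text \<open>A left deletion lowers p by one and a right deletion keeps it, so block p of the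
  boundary receives blocks p + 1 and p, as prescribed in \<open>tensor_complex\<close>.\<close>

lemma block_proj_taylor_bdry:
  fixes y :: "nat set \<Rightarrow>\<^sub>0 ('n, 'k::field) mpoly"
  assumes "Poly_Mapping.keys y \<subseteq> subsets_card (length ms + length ns) i"
  shows "block_proj (length ms) p (lin_ext (taylor_bdry_basis (ms @ ns)) y) =
    left_bdry (block_proj (length ms) (p + 1) y) + scale ((-1) ^ p) (right_bdry (block_proj (length ms) p y))"
proof -
  let ?a = "length ms"
  have "block_proj ?a p (lin_ext (taylor_bdry_basis (ms @ ns)) y) =
      lin_ext (\<lambda>\<rho>. block_proj ?a p (taylor_bdry_basis (ms @ ns) \<rho>)) y"
    by (simp only: block_proj_def lin_ext_lin_ext)
  also have "\<dots> = lin_ext (\<lambda>\<rho>.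
      left_bdry (if card (\<rho> \<inter> {..<?a}) = p + 1 then Poly_Mapping.single \<rho> 1 else 0) +
      scale ((-1) ^ p) (right_bdry (if card (\<rho> \<inter> {..<?a}) = p then Poly_Mapping.single \<rho> 1 else 0))) y"
  proof (rule lin_ext_cong)
    fix \<rho> assume "\<rho> \<in> Poly_Mapping.keys y"
    define \<sigma> \<tau> where "\<sigma> = \<rho> \<inter> {..<?a}" and "\<tau> = right_part ?a \<rho>"
    have \<sigma>: "\<sigma> \<subseteq> {..<?a}" and \<tau>: "\<tau> \<subseteq> {..<length ns}" and \<rho>: "\<rho> = join ?a \<sigma> \<tau>"
      using right_part_subset[of \<rho> ?a "length ns"] assms \<open>\<rho> \<in> Poly_Mapping.keys y\<close>
      by (auto simp: \<sigma>_def \<tau>_def join_parts)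
    let ?X = "tens (join ?a) (taylor_bdry_basis ms \<sigma>) (Poly_Mapping.single \<tau> (1 :: ('n, 'k) mpoly))"
    let ?Y = "tens (join ?a) (Poly_Mapping.single \<sigma> (1 :: ('n, 'k) mpoly)) (taylor_bdry_basis ns \<tau>)"
    have X: "block_proj ?a p ?X = (if p + 1 = card \<sigma> then ?X else 0)"
    proof (cases "card \<sigma>")
      \<comment> \<open>The boundary of the empty set is an empty sum, and p + 1 = 0 is impossible,
        so both sides vanish.\<close>
      case 0
      then have "\<sigma> = {}"
        using \<sigma> by (auto dest: finite_subset)
      then show ?thesis
        by (simp add: taylor_bdry_basis_def tens_def block_proj_def)
    next
      case (Suc s)
      have "Poly_Mapping.keys ?X \<subseteq> case_prod (join ?a) ` (subsets_card ?a s \<times> {\<tau>})"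
        by (rule keys_tens[OF keys_taylor_bdry_basis[OF \<sigma> Suc]]) simp
      then have "\<And>\<rho>. \<rho> \<in> Poly_Mapping.keys ?X \<Longrightarrow> card (\<rho> \<inter> {..<?a}) = s"
        by fastforce
      then show ?thesis
        using Suc by (subst block_proj_eq[where q = s]) auto
    qed
    have Y: "block_proj ?a p ?Y = (if p = card \<sigma> then ?Y else 0)"
    proof (rule block_proj_eq)
      fix \<rho> assume "\<rho> \<in> Poly_Mapping.keys ?Y"
      then show "card (\<rho> \<inter> {..<?a}) = card \<sigma>"
        using keys_tens[of "Poly_Mapping.single \<sigma> 1" "{\<sigma>}" "taylor_bdry_basis ns \<tau>" UNIV "join ?a"] \<sigma> by auto
    qed
    have 1: "block_proj ?a p (taylor_bdry_basis (ms @ ns) \<rho>) =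
        block_proj ?a p ?X + scale ((-1) ^ card \<sigma>) (block_proj ?a p ?Y)"
      by (simp add: \<rho> taylor_bdry_join[OF \<sigma> \<tau>] block_proj_def lin_ext_add lin_ext_scale)
    have 2: "left_bdry (if card (\<rho> \<inter> {..<?a}) = p + 1 then Poly_Mapping.single \<rho> 1 else 0) =
        (if p + 1 = card \<sigma> then ?X else 0)"
      by (simp add: left_bdry_def \<rho> \<sigma>)
    have 3: "right_bdry (if card (\<rho> \<inter> {..<?a}) = p then Poly_Mapping.single \<rho> 1 else 0) =
        (if p = card \<sigma> then ?Y else 0)"
      by (simp add: right_bdry_def \<rho> \<sigma>)
    show "block_proj ?a p (taylor_bdry_basis (ms @ ns) \<rho> :: nat set \<Rightarrow>\<^sub>0 ('n, 'k) mpoly) =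
        left_bdry (if card (\<rho> \<inter> {..<?a}) = p + 1 then Poly_Mapping.single \<rho> 1 else 0) +
        scale ((-1) ^ p) (right_bdry (if card (\<rho> \<inter> {..<?a}) = p then Poly_Mapping.single \<rho> 1 else 0))"
      unfolding 1 2 3 X Y by auto
  qed
  also have "\<dots> = left_bdry (block_proj ?a (p + 1) y) + scale ((-1) ^ p) (right_bdry (block_proj ?a p y))"
    by (simp only: lin_ext_add_fun lin_ext_scale_fun) (simp only: left_bdry_def right_bdry_def block_proj_def lin_ext_lin_ext)
  finally show ?thesis .
qed

lemma taylor_bdry_closed:
  "j = Suc i \<Longrightarrow> lin_ext (taylor_bdry_basis ls) \<in> carrier (free_module (subsets_card n j)) \<rightarrow>
    carrier (free_module (subsets_card n i) :: (('n, 'k::field) mpoly, _) module)"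
  unfolding free_module_simps
  by (intro funcsetI CollectI keys_lin_ext keys_taylor_bdry_basis) auto

text \<open>Supplies the support conditions under which the signed second summand of the tensor
  differential can be scaled and added as a fiber.\<close>

lemma keys_right_bdry:
  assumes "Poly_Mapping.keys y \<subseteq> blocks (length ms) (length ns) p (Suc q)"
  shows "Poly_Mapping.keys (right_bdry y) \<subseteq> blocks (length ms) (length ns) p q"
  unfolding right_bdry_def
proof (rule keys_lin_ext)
  fix \<rho> assume "\<rho> \<in> Poly_Mapping.keys y"
  then obtain \<sigma> \<tau> where "\<rho> = join (length ms) \<sigma> \<tau>" and \<sigma>: "\<sigma> \<subseteq> {..<length ms}" "card \<sigma> = p"
    and \<tau>: "\<tau> \<subseteq> {..<length ns}" "card \<tau> = Suc q"
    using assms by (auto simp flip: image_join)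
  then show "Poly_Mapping.keys (tens (join (length ms)) (Poly_Mapping.single (\<rho> \<inter> {..<length ms}) 1)
      (taylor_bdry_basis ns (right_part (length ms) \<rho>))) \<subseteq> blocks (length ms) (length ns) p q"
    unfolding image_join[symmetric] using keys_taylor_bdry_basis[OF \<tau>] by (intro keys_tens) simp_all
qed

text \<open>An element is cut into its blocks, and each block is replaced by the coset of formal
  sums evaluating to it. Transport shows at the same time that the tensor complex is a
  complex.\<close>

theorem isomorphic_taylor_append:
  "isomorphic_complexes mpoly_ring
    (taylor_complex (ms @ ns) :: (('n, 'k::field) mpoly, _) module_complex)
    (tensor_complex mpoly_ring (taylor_complex ms) (taylor_complex ns))"
proof -
  let ?a = "length ms" and ?b = "length ns"
  define f :: "nat \<Rightarrow> (nat set \<Rightarrow>\<^sub>0 ('n, 'k) mpoly) \<Rightarrow> _" where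
    "f i y = (\<lambda>p\<in>{..i}. block_fiber ?a ?b p (i - p) (block_proj ?a p y))" for i y
  note keys = keys_block_proj[of _ ?a ?b]
  have proj_add: "block_proj ?a p (x + y) = block_proj ?a p x + block_proj ?a p y"
    for p and x y :: "nat set \<Rightarrow>\<^sub>0 ('n, 'k) mpoly"
    by (simp add: block_proj_def lin_ext_add)
  have proj_scale: "block_proj ?a p (scale r x) = scale r (block_proj ?a p x)"
    for p r and x :: "nat set \<Rightarrow>\<^sub>0 ('n, 'k) mpoly"
    by (simp add: block_proj_def lin_ext_scale)
  show ?thesis
  proof (rule isomorphic_complexes_transport[OF chain_complex_taylor, where f = f];
      unfold taylor_complex_simps tensor_complex_simps free_module_simps length_append mem_Collect_eq)
    fix i
    show "bij_betw (f i) {x. Poly_Mapping.keys x \<subseteq> subsets_card (?a + ?b) i}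
        (\<Pi>\<^sub>E p\<in>{..i}. carrier (block_tensor ?a ?b p (i - p)))"
    proof (rule bij_betw_imageI)
      show "inj_on (f i) {x. Poly_Mapping.keys x \<subseteq> subsets_card (?a + ?b) i}"
      proof (rule inj_onI)
        fix x y
        assume x: "x \<in> {x. Poly_Mapping.keys x \<subseteq> subsets_card (?a + ?b) i}"
          and y: "y \<in> {x. Poly_Mapping.keys x \<subseteq> subsets_card (?a + ?b) i}" and eq: "f i x = f i y"
        have "block_proj ?a p x = block_proj ?a p y" if "p \<le> i" for p
          using fun_cong[OF eq, of p] keys[of x i p] x that
          by (intro block_fiber_inj) (auto simp: f_def)
        then have "(\<Sum>p\<le>i. block_proj ?a p x) = (\<Sum>p\<le>i. block_proj ?a p y)"
          by (intro sum.cong) auto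
        then show "x = y"
          using x y by (simp add: sum_block_proj)
      qed
      show "f i ` {x. Poly_Mapping.keys x \<subseteq> subsets_card (?a + ?b) i} =
          (\<Pi>\<^sub>E p\<in>{..i}. carrier (block_tensor ?a ?b p (i - p)))"
      proof (intro equalityI subsetI)
        fix z assume "z \<in> f i ` {x. Poly_Mapping.keys x \<subseteq> subsets_card (?a + ?b) i}"
        then obtain x where x: "Poly_Mapping.keys x \<subseteq> subsets_card (?a + ?b) i" and z: "z = f i x"
          by auto
        have "block_fiber ?a ?b p (i - p) (block_proj ?a p x) \<in> carrier (block_tensor ?a ?b p (i - p))" if "p \<le> i" for p
          unfolding block_tensor_simps using keys[OF x that] by (intro imageI CollectI)
        then show "z \<in> (\<Pi>\<^sub>E p\<in>{..i}. carrier (block_tensor ?a ?b p (i - p)))"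
          by (auto simp: z f_def)
      next
        fix z :: "nat \<Rightarrow> _"
        assume z: "z \<in> (\<Pi>\<^sub>E p\<in>{..i}. carrier (block_tensor ?a ?b p (i - p) :: (('n, 'k) mpoly, _) module))"
        then have "\<forall>p\<in>{..i}. \<exists>y. Poly_Mapping.keys y \<subseteq> blocks ?a ?b p (i - p) \<and> z p = block_fiber ?a ?b p (i - p) y"
          unfolding block_tensor_simps PiE_iff by blast
        then obtain Y where Y: "\<And>p. p \<le> i \<Longrightarrow> Poly_Mapping.keys (Y p) \<subseteq> blocks ?a ?b p (i - p)"
          "\<And>p. p \<le> i \<Longrightarrow> z p = block_fiber ?a ?b p (i - p) (Y p)"
          by (metis atMost_iff)
        \<comment> \<open>Distinct p give disjoint supports, so projecting the sum to block p
          recovers \<open>Y p\<close>.\<close>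
        define y where "y = (\<Sum>p\<le>i. Y p)"
        have "Poly_Mapping.keys y \<subseteq> subsets_card (?a + ?b) i"
          unfolding y_def using Y(1) by (intro keys_sum_subset) (force simp: blocks_def)
        moreover have "block_proj ?a p y = Y p" if "p \<le> i" for p
        proof -
          have "block_proj ?a p (Y q) = (if p = q then Y q else 0)" if "q \<le> i" for q
            using Y(1)[OF that] by (intro block_proj_eq) (auto simp: blocks_def)
          then have "block_proj ?a p y = (\<Sum>q\<le>i. if p = q then Y q else 0)"
            by (simp add: y_def block_proj_def lin_ext_sum)
          then show ?thesis
            using that by simp
        qed
        moreover from this have "f i y = z"
          using z Y(2) by (auto simp: f_def fun_eq_iff PiE_iff extensional_def)
        ultimately show "z \<in> f i ` {x. Poly_Mapping.keys x \<subseteq> subsets_card (?a + ?b) i}"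
          by auto
      qed
    qed
  next
    fix i and x y :: "nat set \<Rightarrow>\<^sub>0 ('n, 'k) mpoly"
    assume xy: "Poly_Mapping.keys x \<subseteq> subsets_card (?a + ?b) i" "Poly_Mapping.keys y \<subseteq> subsets_card (?a + ?b) i"
    show "f i (x + y) = (\<lambda>p\<in>{..i}. f i x p \<oplus>\<^bsub>block_tensor ?a ?b p (i - p)\<^esub> f i y p)"
      by (auto simp: f_def fun_eq_iff proj_add block_tensor_simps keys[OF xy(2)])
  next
    fix i r and x :: "nat set \<Rightarrow>\<^sub>0 ('n, 'k) mpoly"
    assume "Poly_Mapping.keys x \<subseteq> subsets_card (?a + ?b) i"
    then show "f i (scale r x) = (\<lambda>p\<in>{..i}. r \<odot>\<^bsub>block_tensor ?a ?b p (i - p)\<^esub> f i x p)"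
      by (auto simp: f_def fun_eq_iff proj_scale block_tensor_simps keys)
  next
    fix i
    show "f i 0 = (\<lambda>p\<in>{..i}. \<zero>\<^bsub>block_tensor ?a ?b p (i - p)\<^esub>)"
      by (auto simp: f_def fun_eq_iff block_tensor_simps block_proj_def)
  next
    fix i and x :: "nat set \<Rightarrow>\<^sub>0 ('n, 'k) mpoly"
    assume x: "Poly_Mapping.keys x \<subseteq> subsets_card (?a + ?b) (Suc i)"
    show "f i (lin_ext (taylor_bdry_basis (ms @ ns)) x) = (\<lambda>p\<in>{..i}.
        tensor_map mpoly_ring (free_module (subsets_card ?a p)) (free_module (subsets_card ?b (i - p)))
          (lin_ext (taylor_bdry_basis ms)) (\<lambda>b. b) (f (Suc i) x (p + 1))
        \<oplus>\<^bsub>block_tensor ?a ?b p (i - p)\<^esub>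
        ((\<ominus>\<^bsub>mpoly_ring\<^esub> \<one>\<^bsub>mpoly_ring\<^esub>) [^]\<^bsub>mpoly_ring\<^esub> p) \<odot>\<^bsub>block_tensor ?a ?b p (i - p)\<^esub>
          tensor_map mpoly_ring (free_module (subsets_card ?a p)) (free_module (subsets_card ?b (i - p)))
            (\<lambda>a. a) (lin_ext (taylor_bdry_basis ns)) (f (Suc i) x p))"
    proof (rule ext)
      fix p
      show "f i (lin_ext (taylor_bdry_basis (ms @ ns)) x) p = (\<lambda>p\<in>{..i}.
        tensor_map mpoly_ring (free_module (subsets_card ?a p)) (free_module (subsets_card ?b (i - p)))
          (lin_ext (taylor_bdry_basis ms)) (\<lambda>b. b) (f (Suc i) x (p + 1))
        \<oplus>\<^bsub>block_tensor ?a ?b p (i - p)\<^esub>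
        ((\<ominus>\<^bsub>mpoly_ring\<^esub> \<one>\<^bsub>mpoly_ring\<^esub>) [^]\<^bsub>mpoly_ring\<^esub> p) \<odot>\<^bsub>block_tensor ?a ?b p (i - p)\<^esub>
          tensor_map mpoly_ring (free_module (subsets_card ?a p)) (free_module (subsets_card ?b (i - p)))
            (\<lambda>a. a) (lin_ext (taylor_bdry_basis ns)) (f (Suc i) x p)) p"
      proof (cases "p \<le> i")
        case True
        then have q: "Suc i - p = Suc (i - p)" "Suc i - (p + 1) = i - p"
          by auto
        have k1: "Poly_Mapping.keys (block_proj ?a (p + 1) x) \<subseteq> blocks ?a ?b (p + 1) (i - p)"
          using keys[OF x, of "p + 1"] True by simp
        have k2: "Poly_Mapping.keys (block_proj ?a p x) \<subseteq> blocks ?a ?b p (Suc (i - p))"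
          using keys[OF x, of p] True by (simp add: q)
        have t1: "tensor_map mpoly_ring (free_module (subsets_card ?a p)) (free_module (subsets_card ?b (i - p)))
            (lin_ext (taylor_bdry_basis ms)) (\<lambda>b. b) (block_fiber ?a ?b (p + 1) (i - p) (block_proj ?a (p + 1) x)) =
            block_fiber ?a ?b p (i - p) (left_bdry (block_proj ?a (p + 1) x))"
        proof (rule block_tensor_map[OF k1])
          show "lin_ext (taylor_bdry_basis ms) \<in> carrier (free_module (subsets_card ?a (p + 1))) \<rightarrow>
              carrier (free_module (subsets_card ?a p) :: (('n, 'k) mpoly, _) module)"
            by (rule taylor_bdry_closed) simp
        qed (auto simp: left_bdry_def[abs_def] additive_lin_ext left_bdry_tens[unfolded left_bdry_def])
        have t2: "tensor_map mpoly_ring (free_module (subsets_card ?a p)) (free_module (subsets_card ?b (i - p)))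
            (\<lambda>a. a) (lin_ext (taylor_bdry_basis ns)) (block_fiber ?a ?b p (Suc (i - p)) (block_proj ?a p x)) =
            block_fiber ?a ?b p (i - p) (right_bdry (block_proj ?a p x))"
        proof (rule block_tensor_map[OF k2])
          show "lin_ext (taylor_bdry_basis ns) \<in> carrier (free_module (subsets_card ?b (Suc (i - p)))) \<rightarrow>
              carrier (free_module (subsets_card ?b (i - p)) :: (('n, 'k) mpoly, _) module)"
            by (rule taylor_bdry_closed) simp
        qed (auto simp: right_bdry_def[abs_def] additive_lin_ext right_bdry_tens[unfolded right_bdry_def])
        have k3: "Poly_Mapping.keys (scale ((-1) ^ p) (right_bdry (block_proj ?a p x))) \<subseteq> blocks ?a ?b p (i - p)"
          by (rule order_trans[OF keys_scale keys_right_bdry[OF k2]])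
        have "f i (lin_ext (taylor_bdry_basis (ms @ ns)) x) p = block_fiber ?a ?b p (i - p)
            (left_bdry (block_proj ?a (p + 1) x) + scale ((-1) ^ p) (right_bdry (block_proj ?a p x)))"
          using True by (simp only: f_def restrict_apply atMost_iff if_True block_proj_taylor_bdry[OF x])
        moreover have "f (Suc i) x (p + 1) = block_fiber ?a ?b (p + 1) (i - p) (block_proj ?a (p + 1) x)"
          "f (Suc i) x p = block_fiber ?a ?b p (Suc (i - p)) (block_proj ?a p x)"
          using True by (simp_all add: f_def q)
        ultimately show ?thesis
          using True
          by (simp only: restrict_apply atMost_iff if_True t1 t2 q type_ring_simps type_ring_a_inv type_ring_pow
              block_tensor_simps(4)[OF keys_right_bdry[OF k2]] block_tensor_simps(3)[OF k3])
      qed (simp add: f_def)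
    qed
  qed
qed

end


section \<open>Transversal monomial ideals\<close>

lemma keys_monomial [simp]: "Poly_Mapping.keys (monomial t :: ('n::finite, 'k::field) mpoly) = {t}"
  by (simp add: monomial_def)

text \<open>The right-hand side defines an ideal containing the generators, since a multiple of a
  term stays divisible by the same generator. Conversely, each term of such an f is a multiple of a
  generator.\<close>

lemma mem_monomial_ideal_iff:
  fixes f :: "('n::finite, 'k::field) mpoly"
  shows "f \<in> Idl\<^bsub>mpoly_ring\<^esub> (monomial ` S) \<longleftrightarrow>
    (\<forall>t\<in>Poly_Mapping.keys f. \<exists>s\<in>S. Poly_Mapping.lookup s \<le> Poly_Mapping.lookup t)"
proof -
  define M :: "('n, 'k) mpoly set"
    where "M = {f. \<forall>t\<in>Poly_Mapping.keys f. \<exists>s\<in>S. Poly_Mapping.lookup s \<le> Poly_Mapping.lookup t}"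
  interpret cring "mpoly_ring :: ('n, 'k) mpoly ring"
    by (rule cring_type_ring)
  let ?R = "mpoly_ring :: ('n, 'k) mpoly ring"
  have mult: "g * f \<in> M" if "f \<in> M" for f g
  proof -
    have "\<exists>s\<in>S. Poly_Mapping.lookup s \<le> Poly_Mapping.lookup t" if t: "t \<in> Poly_Mapping.keys (g * f)" for t
    proof -
      obtain u w where "t = u + w" "w \<in> Poly_Mapping.keys f"
        using keys_mult[of g f] t by auto
      moreover obtain s where "s \<in> S" "Poly_Mapping.lookup s \<le> Poly_Mapping.lookup w"
        using \<open>f \<in> M\<close> calculation by (auto simp: M_def)
      ultimately show ?thesis
        by (intro bexI[of _ s]) (auto simp: le_fun_def lookup_add trans_le_add2)
    qed
    then show ?thesis
      by (simp add: M_def)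
  qed
  have "ideal M ?R"
  proof (rule idealI)
    show "subgroup M (add_monoid ?R)"
    proof (rule add.subgroupI)
      fix f g assume "f \<in> M" "g \<in> M"
      then show "f \<oplus>\<^bsub>?R\<^esub> g \<in> M"
        using keys_add[of f g] by (auto simp: M_def)
    next
      fix f assume "f \<in> M"
      then show "\<ominus>\<^bsub>?R\<^esub> f \<in> M"
        by (simp add: M_def in_keys_iff)
    next
      have "0 \<in> M"
        by (simp add: M_def)
      then show "M \<noteq> {}"
        by auto
    qed simp
  qed (use mult ring_axioms in \<open>auto simp: mult.commute\<close>)
  moreover have "monomial ` S \<subseteq> M"
    by (auto simp: M_def)
  ultimately have "Idl\<^bsub>?R\<^esub> (monomial ` S) \<subseteq> M"
    by (rule genideal_minimal)
  moreover have "f \<in> Idl\<^bsub>?R\<^esub> (monomial ` S)" if "f \<in> M" for f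
  proof -
    interpret I: ideal "Idl\<^bsub>?R\<^esub> (monomial ` S)" ?R
      by (rule genideal_ideal) simp
    have closed: "(\<Sum>a\<in>A. h a) \<in> Idl\<^bsub>?R\<^esub> (monomial ` S)"
      if "finite A" "\<And>a. a \<in> A \<Longrightarrow> h a \<in> Idl\<^bsub>?R\<^esub> (monomial ` S)" for A and h :: "('n \<Rightarrow>\<^sub>0 nat) \<Rightarrow> ('n, 'k) mpoly"
      using that by (induction A) (use I.a_closed I.zero_closed in auto)
    have "Poly_Mapping.single t c \<in> Idl\<^bsub>?R\<^esub> (monomial ` S)" if t: "t \<in> Poly_Mapping.keys f" for t c
    proof -
      obtain s where s: "s \<in> S" "Poly_Mapping.lookup s \<le> Poly_Mapping.lookup t"
        using \<open>f \<in> M\<close> t by (auto simp: M_def)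
      then have "monomial s \<in> Idl\<^bsub>?R\<^esub> (monomial ` S)"
        using genideal_self[of "monomial ` S"] by auto
      from I.I_l_closed[OF this, of "Poly_Mapping.single (t - s) c"]
      show ?thesis
        using s by (simp add: monomial_def mult_single exponents_diff_add)
    qed
    then have "(\<Sum>t\<in>Poly_Mapping.keys f. Poly_Mapping.single t (Poly_Mapping.lookup f t)) \<in> Idl\<^bsub>?R\<^esub> (monomial ` S)"
      by (intro closed) auto
    then show ?thesis
      by (simp flip: poly_mapping_sum_single)
  qed
  ultimately show ?thesis
    by (auto simp: M_def)
qed

lemma monomial_mem_ideal_iff:
  "monomial t \<in> Idl\<^bsub>mpoly_ring\<^esub> (monomial ` S :: ('n::finite, 'k::field) mpoly set) \<longleftrightarrow>
    (\<exists>s\<in>S. Poly_Mapping.lookup s \<le> Poly_Mapping.lookup t)"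
  by (simp add: mem_monomial_ideal_iff)

section \<open>Minimal generators as antichains for divisibility\<close>

definition antichain :: "('n \<Rightarrow>\<^sub>0 nat) set \<Rightarrow> bool"
  where "antichain S \<longleftrightarrow> (\<forall>s\<in>S. \<forall>t\<in>S. Poly_Mapping.lookup s \<le> Poly_Mapping.lookup t \<longrightarrow> s = t)"

lemma antichainD: "antichain S \<Longrightarrow> s \<in> S \<Longrightarrow> t \<in> S \<Longrightarrow> Poly_Mapping.lookup s \<le> Poly_Mapping.lookup t \<Longrightarrow> s = t"
  by (simp add: antichain_def)

text \<open>A generator that is a proper multiple of another could be dropped without changing the
  ideal.\<close>

lemma antichain_minimal_generators:
  assumes "minimal_generators ms (I :: ('n::finite, 'k::field) mpoly set)"
  shows "antichain (set ms)"
  unfolding antichain_def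
proof (intro ballI impI, rule ccontr)
  fix s t assume st: "s \<in> set ms" "t \<in> set ms" "Poly_Mapping.lookup s \<le> Poly_Mapping.lookup t" "s \<noteq> t"
  have "(\<exists>u\<in>set ms. Poly_Mapping.lookup u \<le> Poly_Mapping.lookup w) \<longleftrightarrow>
      (\<exists>u\<in>set ms - {t}. Poly_Mapping.lookup u \<le> Poly_Mapping.lookup w)" for w
    using st by (metis Diff_iff order_trans singletonD)
  then have "f \<in> Idl\<^bsub>mpoly_ring\<^esub> (monomial ` set ms) \<longleftrightarrow> f \<in> Idl\<^bsub>mpoly_ring\<^esub> (monomial ` (set ms - {t}))"
    for f :: "('n, 'k) mpoly"
    by (simp only: mem_monomial_ideal_iff)
  then have "I = Idl\<^bsub>mpoly_ring\<^esub> (monomial ` (set ms - {t}))"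
    using assms by (auto simp: minimal_generators_def)
  moreover have "set ms - {t} \<subset> set ms"
    using st by auto
  ultimately show False
    using assms unfolding minimal_generators_def by blast
qed

text \<open>The uniqueness of minimal monomial generators: s is divisible by some t in T, which is
  divisible by some u in S. The antichain property gives u = s, so t = s.\<close>

lemma antichain_subset:
  assumes "antichain S"
    and eq: "Idl\<^bsub>mpoly_ring\<^esub> (monomial ` S) = Idl\<^bsub>mpoly_ring\<^esub> (monomial ` T :: ('n::finite, 'k::field) mpoly set)"
  shows "S \<subseteq> T"
proof
  fix s assume s: "s \<in> S"
  have iff: "(\<exists>u\<in>S. Poly_Mapping.lookup u \<le> Poly_Mapping.lookup w) \<longleftrightarrow> (\<exists>u\<in>T. Poly_Mapping.lookup u \<le> Poly_Mapping.lookup w)" for w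
    by (simp only: monomial_mem_ideal_iff[where ?'k = 'k, symmetric] eq)
  obtain t where t: "t \<in> T" "Poly_Mapping.lookup t \<le> Poly_Mapping.lookup s"
    using s iff[of s] by auto
  obtain u where u: "u \<in> S" "Poly_Mapping.lookup u \<le> Poly_Mapping.lookup t"
    using t iff[of t] by auto
  have "u = s"
    using assms(1) u(1) s order_trans[OF u(2) t(2)] by (rule antichainD)
  then have "Poly_Mapping.lookup s = Poly_Mapping.lookup t"
    using t(2) u(2) by (intro antisym) auto
  then show "s \<in> T"
    using t(1) by (simp add: lookup_inject)
qed

lemma disjoint_supports_iff:
  "disjoint_supports s t \<longleftrightarrow> (\<forall>v. Poly_Mapping.lookup s v = 0 \<or> Poly_Mapping.lookup t v = 0)"
  by (auto simp: disjoint_supports_def in_keys_iff)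

text \<open>A pair \<open>(s, t)\<close> with minimal least common multiple violating the claim leads to a
  contradiction: if the exchanged pair \<open>(s', t)\<close> or \<open>(s, t')\<close> is coprime, minimality
  of the generators applies directly; otherwise both pairs have the same least common multiple as \<open>(s,
  t)\<close>, and this forces \<open>s'\<close> to divide \<open>s\<close>.\<close>

lemma disjoint_supports_exchange:
  fixes S T :: "('n::finite \<Rightarrow>\<^sub>0 nat) set"
  assumes S: "antichain S" and T: "antichain T"
    and exchange: "\<And>s t. s \<in> S \<Longrightarrow> t \<in> T \<Longrightarrow> \<exists>s'\<in>S. \<exists>t'\<in>T. \<forall>v.
      Poly_Mapping.lookup s' v + Poly_Mapping.lookup t' v \<le> max (Poly_Mapping.lookup s v) (Poly_Mapping.lookup t v)"
    and "s \<in> S" "t \<in> T"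
  shows "disjoint_supports s t"
  using \<open>s \<in> S\<close> \<open>t \<in> T\<close>
proof (induction "\<Sum>v\<in>UNIV. max (Poly_Mapping.lookup s v) (Poly_Mapping.lookup t v)" arbitrary: s t rule: less_induct)
  case less
  let ?m = "\<lambda>s t v. max (Poly_Mapping.lookup s v) (Poly_Mapping.lookup t v)"
  \<comment> \<open>The inequality makes s' divide s, so s' = s. Then the sum of the exponents of s
    and t is at most their maximum, so one of them is zero at each variable.\<close>
  have left: "disjoint_supports s t"
    if "s' \<in> S" and le: "\<And>v. Poly_Mapping.lookup s' v + Poly_Mapping.lookup t v \<le> ?m s t v" for s'
  proof -
    have "Poly_Mapping.lookup s' v \<le> Poly_Mapping.lookup s v" for v
      using le[of v] by (simp add: max_def split: if_splits)
    then have "s' = s"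
      using S that(1) less.prems by (intro antichainD[OF S]) (auto simp: le_fun_def)
    show ?thesis
      unfolding disjoint_supports_iff
    proof
      fix v show "Poly_Mapping.lookup s v = 0 \<or> Poly_Mapping.lookup t v = 0"
        using le[of v] by (simp add: \<open>s' = s\<close> max_def split: if_splits)
    qed
  qed
  have right: "disjoint_supports s t"
    if "t' \<in> T" and le: "\<And>v. Poly_Mapping.lookup s v + Poly_Mapping.lookup t' v \<le> ?m s t v" for t'
  proof -
    have "Poly_Mapping.lookup t' v \<le> Poly_Mapping.lookup t v" for v
      using le[of v] by (simp add: max_def split: if_splits)
    then have "t' = t"
      using T that(1) less.prems by (intro antichainD[OF T]) (auto simp: le_fun_def)
    show ?thesis
      unfolding disjoint_supports_iff
    proof
      fix v show "Poly_Mapping.lookup s v = 0 \<or> Poly_Mapping.lookup t v = 0"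
        using le[of v] by (simp add: \<open>t' = t\<close> max_def split: if_splits)
    qed
  qed
  \<comment> \<open>A pair that is not coprime cannot have an lcm of smaller degree, by induction;
    as its lcm divides that of (s, t), the two agree.\<close>
  have sum_eq: "?m s1 t1 = ?m s t"
    if "s1 \<in> S" "t1 \<in> T" "\<not> disjoint_supports s1 t1" and le: "\<And>v. ?m s1 t1 v \<le> ?m s t v" for s1 t1
  proof (rule ext, rule ccontr)
    fix v assume "?m s1 t1 v \<noteq> ?m s t v"
    then have "?m s1 t1 v < ?m s t v"
      using le[of v] by (simp only: order.not_eq_order_implies_strict)
    then have "(\<Sum>v\<in>UNIV. ?m s1 t1 v) < (\<Sum>v\<in>UNIV. ?m s t v)"
      using le by (intro sum_strict_mono_ex1) auto
    then show False
      using less.hyps that by blast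
  qed
  have sum_max: "Poly_Mapping.lookup x v + Poly_Mapping.lookup y v = ?m x y v"
    if "disjoint_supports x y" for x y :: "'n \<Rightarrow>\<^sub>0 nat" and v
    using that by (auto simp: disjoint_supports_iff dest: spec[of _ v])
  obtain s' t' where st': "s' \<in> S" "t' \<in> T"
    and le: "\<And>v. Poly_Mapping.lookup s' v + Poly_Mapping.lookup t' v \<le> ?m s t v"
    using exchange[OF less.prems] by auto
  have le1: "?m s' t v \<le> ?m s t v" and le2: "?m s t' v \<le> ?m s t v" for v
    using le[of v] by (auto simp: max_def split: if_splits)
  show ?case
  proof (cases "disjoint_supports s' t \<or> disjoint_supports s t'")
    case True
    then show ?thesis
      using left[OF st'(1)] right[OF st'(2)] le1 le2 by (auto simp: sum_max)
  next
    case False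
    then have eq1: "?m s' t = ?m s t" and eq2: "?m s t' = ?m s t"
      using sum_eq[of s' t] sum_eq[of s t'] st' less.prems le1 le2 by blast+
    \<comment> \<open>Suppose s' exceeds s at v. By \<open>eq1\<close> the exponent of t is at least
      that of s' and exceeds that of s; by \<open>eq2\<close> t' and t then agree at v; now
      \<open>le\<close> leaves exponent 0 for s'.\<close>
    have "Poly_Mapping.lookup s' v \<le> Poly_Mapping.lookup s v" for v
      using le[of v] fun_cong[OF eq1, of v] fun_cong[OF eq2, of v] by (simp add: max_def split: if_splits)
    then have "s' = s"
      using st' less.prems by (intro antichainD[OF S]) (auto simp: le_fun_def)
    then show ?thesis
      using right[OF st'(2)] le by simp
  qed
qed

text \<open>All that is extracted from membership in IJ. Elements of the product ideal arise from
  products by addition, and a term of a product is a product of terms.\<close>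

lemma ideal_prod_keys:
  assumes "f \<in> (Idl\<^bsub>mpoly_ring\<^esub> (monomial ` S)) \<cdot>\<^bsub>mpoly_ring\<^esub> (Idl\<^bsub>mpoly_ring\<^esub> (monomial ` T))"
    and "u \<in> Poly_Mapping.keys (f :: ('n::finite, 'k::field) mpoly)"
  shows "\<exists>s\<in>S. \<exists>t\<in>T. Poly_Mapping.lookup (s + t) \<le> Poly_Mapping.lookup u"
  using assms
proof (induction arbitrary: u)
  case (prod f g)
  then obtain a b where ab: "u = a + b" "a \<in> Poly_Mapping.keys f" "b \<in> Poly_Mapping.keys g"
    using keys_mult[of f g] by auto
  obtain s t where "s \<in> S" "Poly_Mapping.lookup s \<le> Poly_Mapping.lookup a"
    "t \<in> T" "Poly_Mapping.lookup t \<le> Poly_Mapping.lookup b"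
    using prod ab unfolding mem_monomial_ideal_iff by blast
  then show ?case
    by (intro bexI[of _ s] bexI[of _ t]) (auto simp: ab le_fun_def lookup_add add_mono)
next
  case (sum f g)
  then show ?case
    using keys_add[of f g] by auto
qed

text \<open>The lcm of s and t lies in both ideals, hence in IJ, so the product of some generators
  s' and t' divides it. This is the exchange hypothesis.\<close>

lemma transversal_disjoint_supports:
  fixes I J :: "('n::finite, 'k::field) mpoly set"
  assumes trans: "I \<inter> J = I \<cdot>\<^bsub>mpoly_ring\<^esub> J"
    and ms: "minimal_generators ms I" and ns: "minimal_generators ns J"
    and "s \<in> set ms" "t \<in> set ns"
  shows "disjoint_supports s t"
proof (rule disjoint_supports_exchange)
  show "antichain (set ms)" "antichain (set ns)"
    using ms ns by (auto intro: antichain_minimal_generators)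
  fix s t assume st: "s \<in> set ms" "t \<in> set ns"
  have I: "I = Idl\<^bsub>mpoly_ring\<^esub> (monomial ` set ms)" and J: "J = Idl\<^bsub>mpoly_ring\<^esub> (monomial ` set ns)"
    using ms ns by (auto simp: minimal_generators_def)
  define l where "l = lcm_exponents {s, t}"
  have l: "Poly_Mapping.lookup l v = max (Poly_Mapping.lookup s v) (Poly_Mapping.lookup t v)" for v
    by (simp add: l_def lookup_lcm_exponents)
  have "monomial l \<in> I \<inter> J"
    unfolding I J using st
    by (auto simp: monomial_mem_ideal_iff le_fun_def l intro: bexI[of _ s] bexI[of _ t])
  then have "monomial l \<in> I \<cdot>\<^bsub>mpoly_ring\<^esub> J"
    by (simp add: trans)
  then have "\<exists>s'\<in>set ms. \<exists>t'\<in>set ns. Poly_Mapping.lookup (s' + t') \<le> Poly_Mapping.lookup l"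
    unfolding I J by (rule ideal_prod_keys) simp
  then show "\<exists>s'\<in>set ms. \<exists>t'\<in>set ns. \<forall>v. Poly_Mapping.lookup s' v + Poly_Mapping.lookup t' v \<le>
      max (Poly_Mapping.lookup s v) (Poly_Mapping.lookup t v)"
    by (simp add: le_fun_def lookup_add l)
qed fact+

section \<open>Generators of the sum of the two ideals\<close>

lemma sum_monomial_ideals:
  "Idl\<^bsub>mpoly_ring\<^esub> (monomial ` S) <+>\<^bsub>mpoly_ring\<^esub> Idl\<^bsub>mpoly_ring\<^esub> (monomial ` T) =
    Idl\<^bsub>mpoly_ring\<^esub> (monomial ` (S \<union> T) :: ('n::finite, 'k::field) mpoly set)"
proof -
  interpret cring "mpoly_ring :: ('n, 'k) mpoly ring"
    by (rule cring_type_ring)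
  let ?R = "mpoly_ring :: ('n, 'k) mpoly ring"
  let ?I = "\<lambda>S. Idl\<^bsub>?R\<^esub> (monomial ` S)"
  have id: "ideal (?I S) ?R" for S
    by (rule genideal_ideal) simp
  have "?I S <+>\<^bsub>?R\<^esub> ?I T = Idl\<^bsub>?R\<^esub> (?I S \<union> ?I T)"
    by (rule union_genideal[OF id id, symmetric])
  also have "\<dots> = ?I (S \<union> T)"
  proof (intro equalityI genideal_minimal id)
    show "?I S \<union> ?I T \<subseteq> ?I (S \<union> T)"
      unfolding subset_iff Un_iff mem_monomial_ideal_iff by blast
    have "monomial ` (S \<union> T) \<subseteq> ?I S \<union> ?I T"
      by (auto simp: monomial_mem_ideal_iff)
    then show "monomial ` (S \<union> T) \<subseteq> Idl\<^bsub>?R\<^esub> (?I S \<union> ?I T)"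
      using genideal_self[of "?I S \<union> ?I T"] by auto
    show "ideal (Idl\<^bsub>?R\<^esub> (?I S \<union> ?I T)) ?R"
      by (rule genideal_ideal) simp
  qed
  finally show ?thesis .
qed

lemma one_mem_monomial_ideal:
  assumes "0 \<in> S"
  shows "Idl\<^bsub>mpoly_ring\<^esub> (monomial ` S) = carrier (mpoly_ring :: ('n::finite, 'k::field) mpoly ring)"
  using assms by (auto simp: mem_monomial_ideal_iff le_fun_def intro!: bexI[of _ 0])

text \<open>A divisor of t coprime to t is 1, so I would be the unit ideal. The proviso then makes J
  zero, although J contains the monomial t.\<close>

lemma transversal_generators_not_dvd:
  fixes J :: "('n::finite, 'k::field) mpoly set"
  assumes ms: "minimal_generators ms I" and ns: "minimal_generators ns J"
    and proper: "I = carrier mpoly_ring \<longrightarrow> J = {\<zero>\<^bsub>mpoly_ring\<^esub>}"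
    and st: "s \<in> set ms" "t \<in> set ns" "disjoint_supports s t"
  shows "\<not> Poly_Mapping.lookup s \<le> Poly_Mapping.lookup t"
proof
  assume "Poly_Mapping.lookup s \<le> Poly_Mapping.lookup t"
  then have "Poly_Mapping.lookup s v = 0" for v
    using st(3) by (metis disjoint_supports_iff le_funD le_zero_eq)
  then have "s = 0"
    by (intro poly_mapping_eqI) simp
  then have "I = carrier mpoly_ring"
    using ms st(1) one_mem_monomial_ideal[of "set ms"] by (simp add: minimal_generators_def)
  then have "J = {0}"
    using proper by simp
  moreover have "monomial t \<in> J"
    using ns st(2) by (auto simp: minimal_generators_def monomial_mem_ideal_iff)
  ultimately have "(monomial t :: ('n, 'k) mpoly) = 0"
    by simp
  then show False
    by (metis keys_monomial keys_zero insert_not_empty)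
qed

theorem theorem3p2:
  fixes I J :: "('n::finite, 'k::field) mpoly set"
    and ms ns ks :: "('n \<Rightarrow>\<^sub>0 nat) list"
  assumes "monomial_ideal I" and "monomial_ideal J"
    and "I \<inter> J = I \<cdot>\<^bsub>mpoly_ring\<^esub> J"
    and "minimal_generators ms I"
    and "minimal_generators ns J"
    and "minimal_generators ks (I <+>\<^bsub>mpoly_ring\<^esub> J)"
  shows "((I = carrier mpoly_ring \<longrightarrow> J = {\<zero>\<^bsub>mpoly_ring\<^esub>}) \<and>
          (J = carrier mpoly_ring \<longrightarrow> I = {\<zero>\<^bsub>mpoly_ring\<^esub>}) \<longrightarrow>
            isomorphic_complexes (mpoly_ring :: ('n, 'k) mpoly ring)
              (taylor_complex ks)
              (tensor_complex mpoly_ring (taylor_complex ms) (taylor_complex ns))) \<and>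
         acyclic_complex (mpoly_ring :: ('n, 'k) mpoly ring)
           (tensor_complex mpoly_ring (taylor_complex ms) (taylor_complex ns))"
proof (intro conjI impI)
  have disj: "disjoint_supports s t" if "s \<in> set ms" "t \<in> set ns" for s t
    using assms(3-5) that by (rule transversal_disjoint_supports)
  have iso: "isomorphic_complexes (mpoly_ring :: ('n, 'k) mpoly ring) (taylor_complex (ms @ ns))
      (tensor_complex mpoly_ring (taylor_complex ms) (taylor_complex ns))"
    using disj by (rule isomorphic_taylor_append)
  show "acyclic_complex (mpoly_ring :: ('n, 'k) mpoly ring)
      (tensor_complex mpoly_ring (taylor_complex ms) (taylor_complex ns))"
    using iso acyclic_taylor by (rule acyclic_complex_isomorphic)
  assume proper: "(I = carrier mpoly_ring \<longrightarrow> J = {\<zero>\<^bsub>mpoly_ring\<^esub>}) \<and>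
    (J = carrier mpoly_ring \<longrightarrow> I = {\<zero>\<^bsub>mpoly_ring\<^esub>})"
  have not_le: "\<not> Poly_Mapping.lookup s \<le> Poly_Mapping.lookup t" "\<not> Poly_Mapping.lookup t \<le> Poly_Mapping.lookup s"
    if "s \<in> set ms" "t \<in> set ns" for s t
    using transversal_generators_not_dvd[OF assms(4,5) _ that(1,2)]
      transversal_generators_not_dvd[OF assms(5,4) _ that(2,1)] proper disj[OF that]
    by (auto simp: disjoint_supports_iff disj_commute)
  \<comment> \<open>With no divisibility across the two lists, the concatenation is minimal too;
    uniqueness, applied in both directions, identifies it with \<open>ks\<close> as a set.\<close>
  have "antichain (set (ms @ ns))"
    using antichain_minimal_generators[OF assms(4)] antichain_minimal_generators[OF assms(5)] not_le
    unfolding antichain_def set_append by blast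
  moreover have "Idl\<^bsub>mpoly_ring\<^esub> (monomial ` set ks) = Idl\<^bsub>mpoly_ring\<^esub> (monomial ` set (ms @ ns) :: ('n, 'k) mpoly set)"
    using assms(4-6) by (simp add: minimal_generators_def sum_monomial_ideals)
  ultimately have "set ks = set (ms @ ns)"
    using antichain_subset[OF antichain_minimal_generators[OF assms(6)]] antichain_subset[of "set (ms @ ns)" "set ks"]
    by (metis subset_antisym)
  \<comment> \<open>A common generator would divide itself across the lists. Disjointness makes the
    concatenation distinct, hence a reordering of \<open>ks\<close>.\<close>
  moreover have "set ms \<inter> set ns = {}"
    using not_le by blast
  ultimately have "isomorphic_complexes (mpoly_ring :: ('n, 'k) mpoly ring) (taylor_complex ks) (taylor_complex (ms @ ns))"
    using assms(4-6) by (intro isomorphic_taylor_same_set) (auto simp: minimal_generators_def)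
  then show "isomorphic_complexes (mpoly_ring :: ('n, 'k) mpoly ring) (taylor_complex ks)
      (tensor_complex mpoly_ring (taylor_complex ms) (taylor_complex ns))"
    using iso by (rule isomorphic_complexes_trans)
qed

end
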